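(* The theory $\mathsf{E\text{-}PA}^{\omega}_{\mathrm{st}}+\mathsf{OS}_0+\mathsf{CSAT}_0$ interprets full second-order (classical) arithmetic $\mathsf{PA}_2$.
   Context: $\mathsf{E\text{-}HA}^{\omega}$ is extensional Heyting arithmetic in all finite types (intuitionistic logic, constants of G\"odel's $\mathsf{T}$, full induction schema). Only equality at type $0$ is primitive; equality at higher types is defined extensionally. The language of $\mathsf{E\text{-}HA}^{\omega}_{\mathrm{st}}$ adds a unary predicate $\mathrm{st}^\sigma$ and quantifiers $\forall^{\mathrm{st}}x^\sigma,\exists^{\mathrm{st}}x^\sigma$ for every type $\sigma$. Formulas without these new symbols are internal (written with small Greek letters); general formulas may be external (written with capital Greek letters). The system consists of $\mathsf{E\text{-}HA}^{\omega}$ (with its induction schema for internal formulas only), intuitionistic logic for all formulas, and: (1) $\forall^{\mathrm{st}}x\,\Phi(x)\leftrightarrow\forall x(\mathrm{st}(x)\to\Phi(x))$ and $\exists^{\mathrm{st}}x\,\Phi(x)\leftrightarrow\exists x(\mathrm{st}(x)\land\Phi(x))$; (2) $\mathrm{st}(x)\land x=y\to\mathrm{st}(y)$; $\mathrm{st}(t)$ for each closed term $t$ of $\mathsf{T}$; $\mathrm{st}(f)\land\mathrm{st}(x)\to\mathrm{st}(fx)$; (3) external induction: $\big(\Phi(0)\land\forall^{\mathrm{st}}x^0(\Phi(x)\to\Phi(x+1))\big)\to\forall^{\mathrm{st}}x^0\,\Phi(x)$ for arbitrary external $\Phi$. $\mathsf{E\text{-}PA}^{\omega}_{\mathrm{st}}$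 is $\mathsf{E\text{-}HA}^{\omega}_{\mathrm{st}}$ together with the law of excluded middle. $\mathsf{OS}_0$ is the schema $\forall^{\mathrm{st}}x^0\,\varphi(x)\to\exists x^0\,(\lnot\mathrm{st}(x)\land\varphi(x))$, for internal $\varphi$ (parameters allowed). $\mathsf{CSAT}_0$ is the schema $\forall^{\mathrm{st}}n^0\,\exists x^0\,\Phi(n,x)\to\exists f^{0\to0}\,\forall^{\mathrm{st}}n^0\,\Phi(n,f(n))$, for arbitrary external $\Phi$ (parameters allowed). $\mathsf{PA}_2$ is classical second-order arithmetic with full induction and full comprehension for subsets of $\mathbb{N}$. *)

theory Defs
  imports Main
begin

section \<open>The language of nonstandard arithmetic in all finite types\<close>

datatype ty = Base | Arr ty ty  (infixr "\<rightarrow>" 65)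

text \<open>
  Goedel's T in its combinatory version.  Variables are de Bruijn indices kept separately for every
  type: \<open>Var \<sigma> n\<close> is the \<open>n\<close>-th variable of type \<open>\<sigma>\<close>, and a quantifier over type \<open>\<sigma>\<close> binds
  \<open>Var \<sigma> 0\<close> and leaves the indices of all other types alone.
\<close>

datatype tm =
    Var ty nat
  | Zero
  | Succ
  | Proj ty ty
  | Comb ty ty ty
  | Rec ty
  | App tm tm

inductive has_ty :: "tm \<Rightarrow> ty \<Rightarrow> bool" where
  "has_ty (Var \<sigma> n) \<sigma>"
| "has_ty Zero Base"
| "has_ty Succ (Base \<rightarrow> Base)"
| "has_ty (Proj \<sigma> \<tau>) (\<sigma> \<rightarrow> \<tau> \<rightarrow> \<sigma>)"
| "has_ty (Comb \<rho> \<sigma> \<tau>) ((\<rho> \<rightarrow> \<sigma> \<rightarrow> \<tau>) \<rightarrow> (\<rho> \<rightarrow> \<sigma>) \<rightarrow> \<rho> \<rightarrow> \<tau>)"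
| "has_ty (Rec \<sigma>) (\<sigma> \<rightarrow> (\<sigma> \<rightarrow> Base \<rightarrow> \<sigma>) \<rightarrow> Base \<rightarrow> \<sigma>)"
| "has_ty s (\<sigma> \<rightarrow> \<tau>) \<Longrightarrow> has_ty t \<sigma> \<Longrightarrow> has_ty (App s t) \<tau>"

datatype fm =
    Fls
  | Eq tm tm
  | St ty tm
  | Conj fm fm
  | Disj fm fm
  | Imp fm fm
  | All ty fm
  | Ex ty fm
  | AllSt ty fm
  | ExSt ty fm

abbreviation Neg :: "fm \<Rightarrow> fm" where "Neg \<phi> \<equiv> Imp \<phi> Fls"

abbreviation Iff :: "fm \<Rightarrow> fm \<Rightarrow> fm" where "Iff \<phi> \<psi> \<equiv> Conj (Imp \<phi> \<psi>) (Imp \<psi> \<phi>)"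

fun wf_fm :: "fm \<Rightarrow> bool" where
  "wf_fm Fls = True"
| "wf_fm (Eq s t) = (has_ty s Base \<and> has_ty t Base)"
| "wf_fm (St \<sigma> t) = has_ty t \<sigma>"
| "wf_fm (Conj \<phi> \<psi>) = (wf_fm \<phi> \<and> wf_fm \<psi>)"
| "wf_fm (Disj \<phi> \<psi>) = (wf_fm \<phi> \<and> wf_fm \<psi>)"
| "wf_fm (Imp \<phi> \<psi>) = (wf_fm \<phi> \<and> wf_fm \<psi>)"
| "wf_fm (All \<sigma> \<phi>) = wf_fm \<phi>"
| "wf_fm (Ex \<sigma> \<phi>) = wf_fm \<phi>"
| "wf_fm (AllSt \<sigma> \<phi>) = wf_fm \<phi>"
| "wf_fm (ExSt \<sigma> \<phi>) = wf_fm \<phi>"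

fun internal :: "fm \<Rightarrow> bool" where
  "internal Fls = True"
| "internal (Eq s t) = True"
| "internal (St \<sigma> t) = False"
| "internal (Conj \<phi> \<psi>) = (internal \<phi> \<and> internal \<psi>)"
| "internal (Disj \<phi> \<psi>) = (internal \<phi> \<and> internal \<psi>)"
| "internal (Imp \<phi> \<psi>) = (internal \<phi> \<and> internal \<psi>)"
| "internal (All \<sigma> \<phi>) = internal \<phi>"
| "internal (Ex \<sigma> \<phi>) = internal \<phi>"
| "internal (AllSt \<sigma> \<phi>) = False"
| "internal (ExSt \<sigma> \<phi>) = False"

fun fv_tm :: "tm \<Rightarrow> (ty \<times> nat) set" where
  "fv_tm (Var \<sigma> n) = {(\<sigma>, n)}"
| "fv_tm (App s t) = fv_tm s \<union> fv_tm t"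
| "fv_tm _ = {}"

definition unbind :: "ty \<Rightarrow> (ty \<times> nat) set \<Rightarrow> (ty \<times> nat) set" where
  "unbind \<sigma> V = {(\<rho>, n). (\<rho>, if \<rho> = \<sigma> then Suc n else n) \<in> V}"

fun fv_fm :: "fm \<Rightarrow> (ty \<times> nat) set" where
  "fv_fm Fls = {}"
| "fv_fm (Eq s t) = fv_tm s \<union> fv_tm t"
| "fv_fm (St \<sigma> t) = fv_tm t"
| "fv_fm (Conj \<phi> \<psi>) = fv_fm \<phi> \<union> fv_fm \<psi>"
| "fv_fm (Disj \<phi> \<psi>) = fv_fm \<phi> \<union> fv_fm \<psi>"
| "fv_fm (Imp \<phi> \<psi>) = fv_fm \<phi> \<union> fv_fm \<psi>"
| "fv_fm (All \<sigma> \<phi>) = unbind \<sigma> (fv_fm \<phi>)"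
| "fv_fm (Ex \<sigma> \<phi>) = unbind \<sigma> (fv_fm \<phi>)"
| "fv_fm (AllSt \<sigma> \<phi>) = unbind \<sigma> (fv_fm \<phi>)"
| "fv_fm (ExSt \<sigma> \<phi>) = unbind \<sigma> (fv_fm \<phi>)"

type_synonym subst = "ty \<Rightarrow> nat \<Rightarrow> tm"

fun subst_tm :: "subst \<Rightarrow> tm \<Rightarrow> tm" where
  "subst_tm \<theta> (Var \<sigma> n) = \<theta> \<sigma> n"
| "subst_tm \<theta> (App s t) = App (subst_tm \<theta> s) (subst_tm \<theta> t)"
| "subst_tm \<theta> c = c"

definition shift :: "ty \<Rightarrow> subst" where
  "shift \<sigma> = (\<lambda>\<rho> n. Var \<rho> (if \<rho> = \<sigma> then Suc n else n))"

abbreviation lift_tm :: "ty \<Rightarrow> tm \<Rightarrow> tm" where "lift_tm \<sigma> \<equiv> subst_tm (shift \<sigma>)"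

definition up :: "ty \<Rightarrow> subst \<Rightarrow> subst" where
  "up \<sigma> \<theta> = (\<lambda>\<rho> n. if \<rho> = \<sigma> then (case n of 0 \<Rightarrow> Var \<sigma> 0 | Suc m \<Rightarrow> lift_tm \<sigma> (\<theta> \<sigma> m))
                   else lift_tm \<sigma> (\<theta> \<rho> n))"

fun subst_fm :: "subst \<Rightarrow> fm \<Rightarrow> fm" where
  "subst_fm \<theta> Fls = Fls"
| "subst_fm \<theta> (Eq s t) = Eq (subst_tm \<theta> s) (subst_tm \<theta> t)"
| "subst_fm \<theta> (St \<sigma> t) = St \<sigma> (subst_tm \<theta> t)"
| "subst_fm \<theta> (Conj \<phi> \<psi>) = Conj (subst_fm \<theta> \<phi>) (subst_fm \<theta> \<psi>)"
| "subst_fm \<theta> (Disj \<phi> \<psi>) = Disj (subst_fm \<theta> \<phi>) (subst_fm \<theta> \<psi>)"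
| "subst_fm \<theta> (Imp \<phi> \<psi>) = Imp (subst_fm \<theta> \<phi>) (subst_fm \<theta> \<psi>)"
| "subst_fm \<theta> (All \<sigma> \<phi>) = All \<sigma> (subst_fm (up \<sigma> \<theta>) \<phi>)"
| "subst_fm \<theta> (Ex \<sigma> \<phi>) = Ex \<sigma> (subst_fm (up \<sigma> \<theta>) \<phi>)"
| "subst_fm \<theta> (AllSt \<sigma> \<phi>) = AllSt \<sigma> (subst_fm (up \<sigma> \<theta>) \<phi>)"
| "subst_fm \<theta> (ExSt \<sigma> \<phi>) = ExSt \<sigma> (subst_fm (up \<sigma> \<theta>) \<phi>)"

abbreviation lift_fm :: "ty \<Rightarrow> fm \<Rightarrow> fm" where "lift_fm \<sigma> \<equiv> subst_fm (shift \<sigma>)"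

text \<open>\<open>inst \<sigma> t \<phi>\<close> is the body \<open>\<phi>\<close> of a quantifier over type \<open>\<sigma>\<close>, instantiated with \<open>t\<close>.\<close>

definition inst :: "ty \<Rightarrow> tm \<Rightarrow> fm \<Rightarrow> fm" where
  "inst \<sigma> t = subst_fm (\<lambda>\<rho> n. if \<rho> = \<sigma> then (case n of 0 \<Rightarrow> t | Suc m \<Rightarrow> Var \<sigma> m) else Var \<rho> n)"

text \<open>\<open>at_succ \<phi>\<close> is \<open>\<phi>(x + 1)\<close>, still open in the bound variable \<open>x = Var Base 0\<close>.\<close>

definition at_succ :: "fm \<Rightarrow> fm" where
  "at_succ = subst_fm (\<lambda>\<rho> n. if \<rho> = Base \<and> n = 0 then App Succ (Var Base 0) else Var \<rho> n)"

fun ext_eq :: "ty \<Rightarrow> tm \<Rightarrow> tm \<Rightarrow> fm" where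
  "ext_eq Base s t = Eq s t"
| "ext_eq (\<sigma> \<rightarrow> \<tau>) s t =
     All \<sigma> (ext_eq \<tau> (App (lift_tm \<sigma> s) (Var \<sigma> 0)) (App (lift_tm \<sigma> t) (Var \<sigma> 0)))"

section \<open>Intuitionistic natural deduction\<close>

text \<open>
  \<open>A\<close> is the set of axioms and \<open>\<Gamma>\<close> the set of open assumptions.  Axioms may contain free variables
  and are not shifted by the quantifier rules, so they stand for their universal closures.
\<close>

inductive nd :: "fm set \<Rightarrow> fm set \<Rightarrow> fm \<Rightarrow> bool" for A :: "fm set" where
  Ax: "\<phi> \<in> A \<Longrightarrow> wf_fm \<phi> \<Longrightarrow> nd A \<Gamma> \<phi>"
| Asm: "\<phi> \<in> \<Gamma> \<Longrightarrow> wf_fm \<phi> \<Longrightarrow> nd A \<Gamma> \<phi>"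
| FlsE: "nd A \<Gamma> Fls \<Longrightarrow> wf_fm \<phi> \<Longrightarrow> nd A \<Gamma> \<phi>"
| ConjI: "nd A \<Gamma> \<phi> \<Longrightarrow> nd A \<Gamma> \<psi> \<Longrightarrow> nd A \<Gamma> (Conj \<phi> \<psi>)"
| ConjE1: "nd A \<Gamma> (Conj \<phi> \<psi>) \<Longrightarrow> nd A \<Gamma> \<phi>"
| ConjE2: "nd A \<Gamma> (Conj \<phi> \<psi>) \<Longrightarrow> nd A \<Gamma> \<psi>"
| DisjI1: "nd A \<Gamma> \<phi> \<Longrightarrow> wf_fm \<psi> \<Longrightarrow> nd A \<Gamma> (Disj \<phi> \<psi>)"
| DisjI2: "nd A \<Gamma> \<psi> \<Longrightarrow> wf_fm \<phi> \<Longrightarrow> nd A \<Gamma> (Disj \<phi> \<psi>)"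
| DisjE: "nd A \<Gamma> (Disj \<phi> \<psi>) \<Longrightarrow> nd A (insert \<phi> \<Gamma>) \<chi> \<Longrightarrow> nd A (insert \<psi> \<Gamma>) \<chi> \<Longrightarrow> nd A \<Gamma> \<chi>"
| ImpI: "nd A (insert \<phi> \<Gamma>) \<psi> \<Longrightarrow> wf_fm \<phi> \<Longrightarrow> nd A \<Gamma> (Imp \<phi> \<psi>)"
| ImpE: "nd A \<Gamma> (Imp \<phi> \<psi>) \<Longrightarrow> nd A \<Gamma> \<phi> \<Longrightarrow> nd A \<Gamma> \<psi>"
| AllI: "nd A (lift_fm \<sigma> ` \<Gamma>) \<phi> \<Longrightarrow> nd A \<Gamma> (All \<sigma> \<phi>)"
| AllE: "nd A \<Gamma> (All \<sigma> \<phi>) \<Longrightarrow> has_ty t \<sigma> \<Longrightarrow> nd A \<Gamma> (inst \<sigma> t \<phi>)"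
| ExI: "nd A \<Gamma> (inst \<sigma> t \<phi>) \<Longrightarrow> has_ty t \<sigma> \<Longrightarrow> nd A \<Gamma> (Ex \<sigma> \<phi>)"
| ExE: "nd A \<Gamma> (Ex \<sigma> \<phi>) \<Longrightarrow> nd A (insert \<phi> (lift_fm \<sigma> ` \<Gamma>)) (lift_fm \<sigma> \<psi>) \<Longrightarrow> nd A \<Gamma> \<psi>"

section \<open>The systems\<close>

inductive_set EHA :: "fm set" where
  eq_refl: "has_ty t Base \<Longrightarrow> Eq t t \<in> EHA"
| eq_sym: "has_ty s Base \<Longrightarrow> has_ty t Base \<Longrightarrow> Imp (Eq s t) (Eq t s) \<in> EHA"
| eq_trans: "has_ty r Base \<Longrightarrow> has_ty s Base \<Longrightarrow> has_ty t Base \<Longrightarrow>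
    Imp (Conj (Eq r s) (Eq s t)) (Eq r t) \<in> EHA"
| extensionality: "has_ty r (\<sigma> \<rightarrow> \<tau>) \<Longrightarrow> has_ty s \<sigma> \<Longrightarrow> has_ty t \<sigma> \<Longrightarrow>
    Imp (ext_eq \<sigma> s t) (ext_eq \<tau> (App r s) (App r t)) \<in> EHA"
| succ_not_zero: "has_ty t Base \<Longrightarrow> Neg (Eq (App Succ t) Zero) \<in> EHA"
| succ_inj: "has_ty s Base \<Longrightarrow> has_ty t Base \<Longrightarrow>
    Imp (Eq (App Succ s) (App Succ t)) (Eq s t) \<in> EHA"
| proj: "has_ty s \<sigma> \<Longrightarrow> has_ty t \<tau> \<Longrightarrow>
    ext_eq \<sigma> (App (App (Proj \<sigma> \<tau>) s) t) s \<in> EHA"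
| comb: "has_ty r (\<rho> \<rightarrow> \<sigma> \<rightarrow> \<tau>) \<Longrightarrow> has_ty s (\<rho> \<rightarrow> \<sigma>) \<Longrightarrow> has_ty t \<rho> \<Longrightarrow>
    ext_eq \<tau> (App (App (App (Comb \<rho> \<sigma> \<tau>) r) s) t) (App (App r t) (App s t)) \<in> EHA"
| rec_zero: "has_ty s \<sigma> \<Longrightarrow> has_ty r (\<sigma> \<rightarrow> Base \<rightarrow> \<sigma>) \<Longrightarrow>
    ext_eq \<sigma> (App (App (App (Rec \<sigma>) s) r) Zero) s \<in> EHA"
| rec_succ: "has_ty s \<sigma> \<Longrightarrow> has_ty r (\<sigma> \<rightarrow> Base \<rightarrow> \<sigma>) \<Longrightarrow> has_ty t Base \<Longrightarrow>
    ext_eq \<sigma> (App (App (App (Rec \<sigma>) s) r) (App Succ t))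
             (App (App r (App (App (App (Rec \<sigma>) s) r) t)) t) \<in> EHA"
| induction: "wf_fm \<phi> \<Longrightarrow> internal \<phi> \<Longrightarrow>
    Imp (Conj (inst Base Zero \<phi>) (All Base (Imp \<phi> (at_succ \<phi>)))) (All Base \<phi>) \<in> EHA"

inductive_set ST :: "fm set" where
  all_st: "wf_fm \<phi> \<Longrightarrow> Iff (AllSt \<sigma> \<phi>) (All \<sigma> (Imp (St \<sigma> (Var \<sigma> 0)) \<phi>)) \<in> ST"
| ex_st: "wf_fm \<phi> \<Longrightarrow> Iff (ExSt \<sigma> \<phi>) (Ex \<sigma> (Conj (St \<sigma> (Var \<sigma> 0)) \<phi>)) \<in> ST"
| st_eq: "has_ty s \<sigma> \<Longrightarrow> has_ty t \<sigma> \<Longrightarrow> Imp (Conj (St \<sigma> s) (ext_eq \<sigma> s t)) (St \<sigma> t) \<in> ST"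
| st_closed: "has_ty t \<sigma> \<Longrightarrow> fv_tm t = {} \<Longrightarrow> St \<sigma> t \<in> ST"
| st_app: "has_ty s (\<sigma> \<rightarrow> \<tau>) \<Longrightarrow> has_ty t \<sigma> \<Longrightarrow>
    Imp (Conj (St (\<sigma> \<rightarrow> \<tau>) s) (St \<sigma> t)) (St \<tau> (App s t)) \<in> ST"
| external_induction: "wf_fm \<phi> \<Longrightarrow>
    Imp (Conj (inst Base Zero \<phi>) (AllSt Base (Imp \<phi> (at_succ \<phi>)))) (AllSt Base \<phi>) \<in> ST"

definition EHA_st :: "fm set" where
  "EHA_st = EHA \<union> ST"

definition LEM :: "fm set" where
  "LEM = {Disj \<phi> (Neg \<phi>) |\<phi>. wf_fm \<phi>}"

definition EPA_st :: "fm set" where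
  "EPA_st = EHA_st \<union> LEM"

definition OS0 :: "fm set" where
  "OS0 = {Imp (AllSt Base \<phi>) (Ex Base (Conj (Neg (St Base (Var Base 0))) \<phi>)) |\<phi>.
            wf_fm \<phi> \<and> internal \<phi>}"

text \<open>
  In \<open>\<phi>\<close> below, \<open>Var Base 1\<close> is \<open>n\<close> and \<open>Var Base 0\<close> is \<open>x\<close>.  In the conclusion \<open>\<phi>\<close> is moved under
  the quantifier for \<open>f = Var (Base \<rightarrow> Base) 0\<close>, which shifts its parameters of that type, and
  instantiating \<open>x\<close> with \<open>f n\<close> turns \<open>n\<close> into \<open>Var Base 0\<close>.
\<close>

definition CSAT0 :: "fm set" where
  "CSAT0 = {Imp (AllSt Base (Ex Base \<phi>))
              (Ex (Base \<rightarrow> Base) (AllSt Base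
                (inst Base (App (Var (Base \<rightarrow> Base) 0) (Var Base 0)) (lift_fm (Base \<rightarrow> Base) \<phi>)))) |\<phi>.
            wf_fm \<phi>}"

section \<open>Classical second-order arithmetic\<close>

text \<open>
  A two-sorted language with separate de Bruijn indices for number and set variables.  Set terms are
  variables only.
\<close>

datatype ntm =
    NVar nat
  | NZero
  | NSuc ntm
  | NPlus ntm ntm
  | NTimes ntm ntm

datatype pfm =
    PFls
  | PEq ntm ntm
  | PMem ntm nat
  | PConj pfm pfm
  | PDisj pfm pfm
  | PImp pfm pfm
  | AllN pfm
  | ExN pfm
  | AllS pfm
  | ExS pfm

abbreviation PNeg :: "pfm \<Rightarrow> pfm" where "PNeg \<phi> \<equiv> PImp \<phi> PFls"

abbreviation PIff :: "pfm \<Rightarrow> pfm \<Rightarrow> pfm" where "PIff \<phi> \<psi> \<equiv> PConj (PImp \<phi> \<psi>) (PImp \<psi> \<phi>)"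

fun fv_ntm :: "ntm \<Rightarrow> nat set" where
  "fv_ntm (NVar n) = {n}"
| "fv_ntm NZero = {}"
| "fv_ntm (NSuc t) = fv_ntm t"
| "fv_ntm (NPlus s t) = fv_ntm s \<union> fv_ntm t"
| "fv_ntm (NTimes s t) = fv_ntm s \<union> fv_ntm t"

fun fv_num :: "pfm \<Rightarrow> nat set" where
  "fv_num PFls = {}"
| "fv_num (PEq s t) = fv_ntm s \<union> fv_ntm t"
| "fv_num (PMem t X) = fv_ntm t"
| "fv_num (PConj \<phi> \<psi>) = fv_num \<phi> \<union> fv_num \<psi>"
| "fv_num (PDisj \<phi> \<psi>) = fv_num \<phi> \<union> fv_num \<psi>"
| "fv_num (PImp \<phi> \<psi>) = fv_num \<phi> \<union> fv_num \<psi>"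
| "fv_num (AllN \<phi>) = {n. Suc n \<in> fv_num \<phi>}"
| "fv_num (ExN \<phi>) = {n. Suc n \<in> fv_num \<phi>}"
| "fv_num (AllS \<phi>) = fv_num \<phi>"
| "fv_num (ExS \<phi>) = fv_num \<phi>"

fun fv_set :: "pfm \<Rightarrow> nat set" where
  "fv_set PFls = {}"
| "fv_set (PEq s t) = {}"
| "fv_set (PMem t X) = {X}"
| "fv_set (PConj \<phi> \<psi>) = fv_set \<phi> \<union> fv_set \<psi>"
| "fv_set (PDisj \<phi> \<psi>) = fv_set \<phi> \<union> fv_set \<psi>"
| "fv_set (PImp \<phi> \<psi>) = fv_set \<phi> \<union> fv_set \<psi>"
| "fv_set (AllN \<phi>) = fv_set \<phi>"
| "fv_set (ExN \<phi>) = fv_set \<phi>"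
| "fv_set (AllS \<phi>) = {n. Suc n \<in> fv_set \<phi>}"
| "fv_set (ExS \<phi>) = {n. Suc n \<in> fv_set \<phi>}"

definition sentence :: "pfm \<Rightarrow> bool" where
  "sentence \<phi> \<longleftrightarrow> fv_num \<phi> = {} \<and> fv_set \<phi> = {}"

fun subst_ntm :: "(nat \<Rightarrow> ntm) \<Rightarrow> ntm \<Rightarrow> ntm" where
  "subst_ntm \<theta> (NVar n) = \<theta> n"
| "subst_ntm \<theta> NZero = NZero"
| "subst_ntm \<theta> (NSuc t) = NSuc (subst_ntm \<theta> t)"
| "subst_ntm \<theta> (NPlus s t) = NPlus (subst_ntm \<theta> s) (subst_ntm \<theta> t)"
| "subst_ntm \<theta> (NTimes s t) = NTimes (subst_ntm \<theta> s) (subst_ntm \<theta> t)"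

definition up_num :: "(nat \<Rightarrow> ntm) \<Rightarrow> nat \<Rightarrow> ntm" where
  "up_num \<theta> = case_nat (NVar 0) (\<lambda>n. subst_ntm (\<lambda>k. NVar (Suc k)) (\<theta> n))"

definition up_set :: "(nat \<Rightarrow> nat) \<Rightarrow> nat \<Rightarrow> nat" where
  "up_set \<xi> = case_nat 0 (\<lambda>n. Suc (\<xi> n))"

fun subst_pfm :: "(nat \<Rightarrow> ntm) \<Rightarrow> (nat \<Rightarrow> nat) \<Rightarrow> pfm \<Rightarrow> pfm" where
  "subst_pfm \<theta> \<xi> PFls = PFls"
| "subst_pfm \<theta> \<xi> (PEq s t) = PEq (subst_ntm \<theta> s) (subst_ntm \<theta> t)"
| "subst_pfm \<theta> \<xi> (PMem t X) = PMem (subst_ntm \<theta> t) (\<xi> X)"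
| "subst_pfm \<theta> \<xi> (PConj \<phi> \<psi>) = PConj (subst_pfm \<theta> \<xi> \<phi>) (subst_pfm \<theta> \<xi> \<psi>)"
| "subst_pfm \<theta> \<xi> (PDisj \<phi> \<psi>) = PDisj (subst_pfm \<theta> \<xi> \<phi>) (subst_pfm \<theta> \<xi> \<psi>)"
| "subst_pfm \<theta> \<xi> (PImp \<phi> \<psi>) = PImp (subst_pfm \<theta> \<xi> \<phi>) (subst_pfm \<theta> \<xi> \<psi>)"
| "subst_pfm \<theta> \<xi> (AllN \<phi>) = AllN (subst_pfm (up_num \<theta>) \<xi> \<phi>)"
| "subst_pfm \<theta> \<xi> (ExN \<phi>) = ExN (subst_pfm (up_num \<theta>) \<xi> \<phi>)"
| "subst_pfm \<theta> \<xi> (AllS \<phi>) = AllS (subst_pfm \<theta> (up_set \<xi>) \<phi>)"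
| "subst_pfm \<theta> \<xi> (ExS \<phi>) = ExS (subst_pfm \<theta> (up_set \<xi>) \<phi>)"

abbreviation lift_num :: "pfm \<Rightarrow> pfm" where "lift_num \<equiv> subst_pfm (\<lambda>n. NVar (Suc n)) id"

abbreviation lift_set :: "pfm \<Rightarrow> pfm" where "lift_set \<equiv> subst_pfm NVar Suc"

definition inst_num :: "ntm \<Rightarrow> pfm \<Rightarrow> pfm" where
  "inst_num t = subst_pfm (case_nat t NVar) id"

definition inst_set :: "nat \<Rightarrow> pfm \<Rightarrow> pfm" where
  "inst_set X = subst_pfm NVar (case_nat X id)"

definition at_suc :: "pfm \<Rightarrow> pfm" where
  "at_suc = subst_pfm (case_nat (NSuc (NVar 0)) (\<lambda>n. NVar (Suc n))) id"

text \<open>Classical natural deduction; axioms stand for their universal closures, as above.\<close>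

inductive pnd :: "pfm set \<Rightarrow> pfm set \<Rightarrow> pfm \<Rightarrow> bool" for A :: "pfm set" where
  PAx: "\<phi> \<in> A \<Longrightarrow> pnd A \<Gamma> \<phi>"
| PAsm: "\<phi> \<in> \<Gamma> \<Longrightarrow> pnd A \<Gamma> \<phi>"
| PClassical: "pnd A (insert (PNeg \<phi>) \<Gamma>) PFls \<Longrightarrow> pnd A \<Gamma> \<phi>"
| PConjI: "pnd A \<Gamma> \<phi> \<Longrightarrow> pnd A \<Gamma> \<psi> \<Longrightarrow> pnd A \<Gamma> (PConj \<phi> \<psi>)"
| PConjE1: "pnd A \<Gamma> (PConj \<phi> \<psi>) \<Longrightarrow> pnd A \<Gamma> \<phi>"
| PConjE2: "pnd A \<Gamma> (PConj \<phi> \<psi>) \<Longrightarrow> pnd A \<Gamma> \<psi>"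
| PDisjI1: "pnd A \<Gamma> \<phi> \<Longrightarrow> pnd A \<Gamma> (PDisj \<phi> \<psi>)"
| PDisjI2: "pnd A \<Gamma> \<psi> \<Longrightarrow> pnd A \<Gamma> (PDisj \<phi> \<psi>)"
| PDisjE: "pnd A \<Gamma> (PDisj \<phi> \<psi>) \<Longrightarrow> pnd A (insert \<phi> \<Gamma>) \<chi> \<Longrightarrow> pnd A (insert \<psi> \<Gamma>) \<chi> \<Longrightarrow> pnd A \<Gamma> \<chi>"
| PImpI: "pnd A (insert \<phi> \<Gamma>) \<psi> \<Longrightarrow> pnd A \<Gamma> (PImp \<phi> \<psi>)"
| PImpE: "pnd A \<Gamma> (PImp \<phi> \<psi>) \<Longrightarrow> pnd A \<Gamma> \<phi> \<Longrightarrow> pnd A \<Gamma> \<psi>"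
| AllNI: "pnd A (lift_num ` \<Gamma>) \<phi> \<Longrightarrow> pnd A \<Gamma> (AllN \<phi>)"
| AllNE: "pnd A \<Gamma> (AllN \<phi>) \<Longrightarrow> pnd A \<Gamma> (inst_num t \<phi>)"
| ExNI: "pnd A \<Gamma> (inst_num t \<phi>) \<Longrightarrow> pnd A \<Gamma> (ExN \<phi>)"
| ExNE: "pnd A \<Gamma> (ExN \<phi>) \<Longrightarrow> pnd A (insert \<phi> (lift_num ` \<Gamma>)) (lift_num \<psi>) \<Longrightarrow> pnd A \<Gamma> \<psi>"
| AllSI: "pnd A (lift_set ` \<Gamma>) \<phi> \<Longrightarrow> pnd A \<Gamma> (AllS \<phi>)"
| AllSE: "pnd A \<Gamma> (AllS \<phi>) \<Longrightarrow> pnd A \<Gamma> (inst_set X \<phi>)"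
| ExSI: "pnd A \<Gamma> (inst_set X \<phi>) \<Longrightarrow> pnd A \<Gamma> (ExS \<phi>)"
| ExSE: "pnd A \<Gamma> (ExS \<phi>) \<Longrightarrow> pnd A (insert \<phi> (lift_set ` \<Gamma>)) (lift_set \<psi>) \<Longrightarrow> pnd A \<Gamma> \<psi>"

text \<open>
  Equality is primitive between numbers only, as usual; equality of sets is coextensiveness.  The
  comprehension formula is shifted under the quantifier for the new set, which therefore does not
  occur in it.
\<close>

inductive_set PA2 :: "pfm set" where
  p_refl: "PEq t t \<in> PA2"
| p_sym: "PImp (PEq s t) (PEq t s) \<in> PA2"
| p_trans: "PImp (PConj (PEq r s) (PEq s t)) (PEq r t) \<in> PA2"
| p_cong_suc: "PImp (PEq s t) (PEq (NSuc s) (NSuc t)) \<in> PA2"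
| p_cong_plus: "PImp (PConj (PEq s s') (PEq t t')) (PEq (NPlus s t) (NPlus s' t')) \<in> PA2"
| p_cong_times: "PImp (PConj (PEq s s') (PEq t t')) (PEq (NTimes s t) (NTimes s' t')) \<in> PA2"
| p_cong_mem: "PImp (PConj (PEq s t) (PMem s X)) (PMem t X) \<in> PA2"
| p_suc_not_zero: "PNeg (PEq (NSuc t) NZero) \<in> PA2"
| p_suc_inj: "PImp (PEq (NSuc s) (NSuc t)) (PEq s t) \<in> PA2"
| p_plus_zero: "PEq (NPlus s NZero) s \<in> PA2"
| p_plus_suc: "PEq (NPlus s (NSuc t)) (NSuc (NPlus s t)) \<in> PA2"
| p_times_zero: "PEq (NTimes s NZero) NZero \<in> PA2"
| p_times_suc: "PEq (NTimes s (NSuc t)) (NPlus (NTimes s t) s) \<in> PA2"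
| p_induction:
    "PImp (PConj (inst_num NZero \<phi>) (AllN (PImp \<phi> (at_suc \<phi>)))) (AllN \<phi>) \<in> PA2"
| p_comprehension:
    "ExS (AllN (PIff (PMem (NVar 0) 0) (lift_set \<phi>))) \<in> PA2"

section \<open>Interpretations\<close>

text \<open>
  A relative interpretation of the language of second-order arithmetic: for both sorts a type and a
  domain formula over it, and for equality, membership and the graph of each function symbol a
  formula.  The \<open>i\<close>-th argument of such a formula is the variable with index \<open>i\<close> of the type
  belonging to its sort; the value is the last argument of a graph.  In \<open>i_mem\<close> the number is
  argument \<open>0\<close> and the set argument \<open>1\<close>, also if the two types differ.
\<close>

record interp =
  num_ty :: ty
  set_ty :: ty
  num_dom :: fm
  set_dom :: fm
  i_eq :: fm
  i_mem :: fm
  i_zero :: fm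
  i_suc :: fm
  i_plus :: fm
  i_times :: fm

definition has_args :: "fm \<Rightarrow> ty list \<Rightarrow> bool" where
  "has_args \<phi> \<sigma>s \<longleftrightarrow> wf_fm \<phi> \<and> fv_fm \<phi> \<subseteq> {(\<sigma>s ! i, i) |i. i < length \<sigma>s}"

definition wf_interp :: "interp \<Rightarrow> bool" where
  "wf_interp I \<longleftrightarrow>
     has_args (num_dom I) [num_ty I] \<and>
     has_args (set_dom I) [set_ty I] \<and>
     has_args (i_eq I) [num_ty I, num_ty I] \<and>
     has_args (i_mem I) [num_ty I, set_ty I] \<and>
     has_args (i_zero I) [num_ty I] \<and>
     has_args (i_suc I) [num_ty I, num_ty I] \<and>
     has_args (i_plus I) [num_ty I, num_ty I, num_ty I] \<and>
     has_args (i_times I) [num_ty I, num_ty I, num_ty I]"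

definition app_fm :: "fm \<Rightarrow> tm list \<Rightarrow> fm" where
  "app_fm \<phi> ts = subst_fm (\<lambda>\<rho> k. if k < length ts then ts ! k else Var \<rho> k) \<phi>"

definition all_num :: "interp \<Rightarrow> fm \<Rightarrow> fm" where
  "all_num I \<phi> = All (num_ty I) (Imp (app_fm (num_dom I) [Var (num_ty I) 0]) \<phi>)"

definition ex_num :: "interp \<Rightarrow> fm \<Rightarrow> fm" where
  "ex_num I \<phi> = Ex (num_ty I) (Conj (app_fm (num_dom I) [Var (num_ty I) 0]) \<phi>)"

definition all_set :: "interp \<Rightarrow> fm \<Rightarrow> fm" where
  "all_set I \<phi> = All (set_ty I) (Imp (app_fm (set_dom I) [Var (set_ty I) 0]) \<phi>)"

definition ex_set :: "interp \<Rightarrow> fm \<Rightarrow> fm" where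
  "ex_set I \<phi> = Ex (set_ty I) (Conj (app_fm (set_dom I) [Var (set_ty I) 0]) \<phi>)"

text \<open>
  \<open>tr_val I \<nu> t y\<close> says that \<open>y\<close> is a value of \<open>t\<close> in the interpretation, where \<open>\<nu>\<close> sends the number
  variables to terms of type \<open>num_ty I\<close>: nested function symbols are eliminated in favour of the
  formulas for their graphs.
\<close>

fun tr_val :: "interp \<Rightarrow> (nat \<Rightarrow> tm) \<Rightarrow> ntm \<Rightarrow> tm \<Rightarrow> fm" where
  "tr_val I \<nu> (NVar n) y = app_fm (i_eq I) [\<nu> n, y]"
| "tr_val I \<nu> NZero y = app_fm (i_zero I) [y]"
| "tr_val I \<nu> (NSuc t) y =
     (let \<sigma> = num_ty I; up1 = lift_tm \<sigma> in
      ex_num I (Conj (tr_val I (up1 \<circ> \<nu>) t (Var \<sigma> 0))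
                     (app_fm (i_suc I) [Var \<sigma> 0, up1 y])))"
| "tr_val I \<nu> (NPlus s t) y =
     (let \<sigma> = num_ty I; up2 = lift_tm \<sigma> \<circ> lift_tm \<sigma> in
      ex_num I (ex_num I (Conj (Conj (tr_val I (up2 \<circ> \<nu>) s (Var \<sigma> 1))
                                     (tr_val I (up2 \<circ> \<nu>) t (Var \<sigma> 0)))
                               (app_fm (i_plus I) [Var \<sigma> 1, Var \<sigma> 0, up2 y]))))"
| "tr_val I \<nu> (NTimes s t) y =
     (let \<sigma> = num_ty I; up2 = lift_tm \<sigma> \<circ> lift_tm \<sigma> in
      ex_num I (ex_num I (Conj (Conj (tr_val I (up2 \<circ> \<nu>) s (Var \<sigma> 1))
                                     (tr_val I (up2 \<circ> \<nu>) t (Var \<sigma> 0)))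
                               (app_fm (i_times I) [Var \<sigma> 1, Var \<sigma> 0, up2 y]))))"

fun tr :: "interp \<Rightarrow> (nat \<Rightarrow> tm) \<Rightarrow> (nat \<Rightarrow> tm) \<Rightarrow> pfm \<Rightarrow> fm" where
  "tr I \<nu> \<mu> PFls = Fls"
| "tr I \<nu> \<mu> (PEq s t) =
     (let \<sigma> = num_ty I; up2 = lift_tm \<sigma> \<circ> lift_tm \<sigma> in
      ex_num I (ex_num I (Conj (Conj (tr_val I (up2 \<circ> \<nu>) s (Var \<sigma> 1))
                                     (tr_val I (up2 \<circ> \<nu>) t (Var \<sigma> 0)))
                               (app_fm (i_eq I) [Var \<sigma> 1, Var \<sigma> 0]))))"
| "tr I \<nu> \<mu> (PMem t X) =
     (let \<sigma> = num_ty I; up1 = lift_tm \<sigma> in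
      ex_num I (Conj (tr_val I (up1 \<circ> \<nu>) t (Var \<sigma> 0))
                     (app_fm (i_mem I) [Var \<sigma> 0, up1 (\<mu> X)])))"
| "tr I \<nu> \<mu> (PConj \<phi> \<psi>) = Conj (tr I \<nu> \<mu> \<phi>) (tr I \<nu> \<mu> \<psi>)"
| "tr I \<nu> \<mu> (PDisj \<phi> \<psi>) = Disj (tr I \<nu> \<mu> \<phi>) (tr I \<nu> \<mu> \<psi>)"
| "tr I \<nu> \<mu> (PImp \<phi> \<psi>) = Imp (tr I \<nu> \<mu> \<phi>) (tr I \<nu> \<mu> \<psi>)"
| "tr I \<nu> \<mu> (AllN \<phi>) =
     (let \<sigma> = num_ty I; up1 = lift_tm \<sigma> in
      all_num I (tr I (case_nat (Var \<sigma> 0) (up1 \<circ> \<nu>)) (up1 \<circ> \<mu>) \<phi>))"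
| "tr I \<nu> \<mu> (ExN \<phi>) =
     (let \<sigma> = num_ty I; up1 = lift_tm \<sigma> in
      ex_num I (tr I (case_nat (Var \<sigma> 0) (up1 \<circ> \<nu>)) (up1 \<circ> \<mu>) \<phi>))"
| "tr I \<nu> \<mu> (AllS \<phi>) =
     (let \<sigma> = set_ty I; up1 = lift_tm \<sigma> in
      all_set I (tr I (up1 \<circ> \<nu>) (case_nat (Var \<sigma> 0) (up1 \<circ> \<mu>)) \<phi>))"
| "tr I \<nu> \<mu> (ExS \<phi>) =
     (let \<sigma> = set_ty I; up1 = lift_tm \<sigma> in
      ex_set I (tr I (up1 \<circ> \<nu>) (case_nat (Var \<sigma> 0) (up1 \<circ> \<mu>)) \<phi>))"

text \<open>The translation of a sentence does not depend on the environments chosen here.\<close>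

definition tr_sentence :: "interp \<Rightarrow> pfm \<Rightarrow> fm" where
  "tr_sentence I = tr I (Var (num_ty I)) (Var (set_ty I))"

text \<open>
  The theory with axioms \<open>T\<close> interprets the classical theory with axioms \<open>U\<close>.  Since the theorems of
  \<open>U\<close> include all logically valid sentences, it is not necessary to require separately that the
  domains are provably nonempty.  Likewise, if \<open>U\<close> contains the axioms of equality, then totality
  and functionality of the graphs, up to the interpreted equality, and the congruence properties are
  translations of theorems of \<open>U\<close>.
\<close>

definition interprets :: "fm set \<Rightarrow> pfm set \<Rightarrow> bool" where
  "interprets T U \<longleftrightarrow>
     (\<exists>I. wf_interp I \<and> (\<forall>\<phi>. sentence \<phi> \<and> pnd U {} \<phi> \<longrightarrow> nd T {} (tr_sentence I \<phi>)))"

end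

theory Submission
  imports Defs
begin

text \<open>
  Let the numbers of the interpretation be the standard objects of type 0 and its sets all functions
  \<open>f\<close> of type 0 to 0, standard or not, with \<open>n\<close> an element of \<open>f\<close> iff \<open>f n = 0\<close>.  The translation of a
  formula of second-order arithmetic is then an external formula, because its number quantifiers
  range over standard numbers, and two schemata for arbitrary external formulas do the work.
  Induction becomes external induction.  Comprehension for \<open>\<phi>(n)\<close> comes from saturation: by excluded
  middle, every \<open>n\<close> has an \<open>x\<close> with \<open>x = 0 \<longleftrightarrow> \<phi>(n)\<close>, namely 0 or 1, so \<open>CSAT0\<close> yields an \<open>f\<close> with
  \<open>f n = 0 \<longleftrightarrow> \<phi>(n)\<close> for all standard \<open>n\<close>, which is the required set (\<open>characteristic_value\<close>,
  \<open>relat_comprehension\<close>).  The other axioms concern addition and multiplication.  These are terms of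
  Goedel's T, hence lead from standard numbers to standard numbers, and their recursion equations
  hold for all numbers.

  The translation that defines interpretability removes nested function symbols in favour of their
  graphs and therefore does not commute literally with the substitution of terms.  The quantifier
  rules are easier to follow through a second translation \<open>relat\<close>, which sends arithmetical terms to
  terms of T: it commutes with substitution on the nose (\<open>relat_subst\<close>, \<open>subst_relat\<close>) and takes
  derivations to derivations rule by rule (\<open>relat_sound\<close>).  The two translations are provably
  equivalent for standard parameters (\<open>tr_iff\<close>), since an auxiliary quantifier for the value of a
  subterm can be eliminated against the equation that determines this value (\<open>one_point\<close>).
\<close>

section \<open>Typing and substitution\<close>

text \<open>
  The value at \<open>Base\<close> is a dummy.  A term whose type would be computed from it is not \<open>well_typed\<close>.
\<close>

fun cod :: "ty \<Rightarrow> ty" where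
  "cod (\<sigma> \<rightarrow> \<tau>) = \<tau>"
| "cod Base = Base"

fun ty_of :: "tm \<Rightarrow> ty" where
  "ty_of (Var \<sigma> n) = \<sigma>"
| "ty_of Zero = Base"
| "ty_of Succ = Base \<rightarrow> Base"
| "ty_of (Proj \<sigma> \<tau>) = \<sigma> \<rightarrow> \<tau> \<rightarrow> \<sigma>"
| "ty_of (Comb \<rho> \<sigma> \<tau>) = (\<rho> \<rightarrow> \<sigma> \<rightarrow> \<tau>) \<rightarrow> (\<rho> \<rightarrow> \<sigma>) \<rightarrow> \<rho> \<rightarrow> \<tau>"
| "ty_of (Rec \<sigma>) = \<sigma> \<rightarrow> (\<sigma> \<rightarrow> Base \<rightarrow> \<sigma>) \<rightarrow> Base \<rightarrow> \<sigma>"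
| "ty_of (App s t) = cod (ty_of s)"

fun well_typed :: "tm \<Rightarrow> bool" where
  "well_typed (App s t) \<longleftrightarrow> well_typed s \<and> well_typed t \<and> ty_of s = ty_of t \<rightarrow> cod (ty_of s)"
| "well_typed t \<longleftrightarrow> True"

text \<open>
  A term has at most one type.  Computing it turns the typing conditions of the calculus, which often
  contain types that unification leaves open, into rewriting.
\<close>

lemma has_ty_iff [simp]: "has_ty t \<tau> \<longleftrightarrow> well_typed t \<and> ty_of t = \<tau>"
proof
  show "has_ty t \<tau> \<Longrightarrow> well_typed t \<and> ty_of t = \<tau>"
    by (induction rule: has_ty.induct) auto
  have "well_typed t \<Longrightarrow> has_ty t (ty_of t)"
  proof (induction t)
    case (App s t)
    then show ?case by (auto intro: has_ty.intros(7)[where \<sigma> = "ty_of t"])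
  qed (auto intro: has_ty.intros)
  then show "well_typed t \<and> ty_of t = \<tau> \<Longrightarrow> has_ty t \<tau>" by auto
qed

definition typed :: "subst \<Rightarrow> bool" where
  "typed \<theta> \<longleftrightarrow> (\<forall>\<sigma> n. has_ty (\<theta> \<sigma> n) \<sigma>)"

lemma ty_of_subst [simp]: "typed \<theta> \<Longrightarrow> ty_of (subst_tm \<theta> t) = ty_of t"
  by (induction t) (auto simp: typed_def)

lemma well_typed_subst [simp]: "typed \<theta> \<Longrightarrow> well_typed (subst_tm \<theta> t) = well_typed t"
  by (induction t) (auto simp: typed_def)

lemma typed_shift [simp]: "typed (shift \<sigma>)"
  by (simp add: typed_def shift_def)

lemma typed_up [simp]:
  assumes "typed \<theta>"
  shows "typed (up \<sigma> \<theta>)"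
  unfolding typed_def up_def using assms[unfolded typed_def] by (auto split: nat.split)

lemma wf_subst [simp]: "typed \<theta> \<Longrightarrow> wf_fm (subst_fm \<theta> \<phi>) \<longleftrightarrow> wf_fm \<phi>"
  by (induction \<phi> arbitrary: \<theta>) auto

lemma subst_tm_subst_tm:
  "subst_tm \<theta> (subst_tm \<eta> t) = subst_tm (\<lambda>\<rho> n. subst_tm \<theta> (\<eta> \<rho> n)) t"
  by (induction t) auto

lemma subst_tm_Var [simp]: "subst_tm Var t = t"
  by (induction t) auto

lemma up_Var [simp]: "up \<sigma> Var = Var"
  by (auto simp: up_def shift_def fun_eq_iff split: nat.split)

lemma subst_fm_Var [simp]: "subst_fm Var \<phi> = \<phi>"
  by (induction \<phi>) auto

lemma subst_up_lift [simp]: "subst_tm (up \<sigma> \<theta>) (lift_tm \<sigma> t) = lift_tm \<sigma> (subst_tm \<theta> t)"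
  unfolding subst_tm_subst_tm
  by (rule arg_cong[where f = "\<lambda>\<theta>. subst_tm \<theta> t"]) (auto simp: fun_eq_iff shift_def up_def)

lemma subst_up_Var [simp]: "up \<sigma> \<theta> \<sigma> 0 = Var \<sigma> 0"
  by (simp add: up_def)

lemma up_comp: "up \<sigma> (\<lambda>\<rho> n. subst_tm \<theta> (\<eta> \<rho> n)) = (\<lambda>\<rho> n. subst_tm (up \<sigma> \<theta>) (up \<sigma> \<eta> \<rho> n))"
  by (auto simp: fun_eq_iff up_def[of _ \<eta>] up_def[of _ "\<lambda>\<rho> n. subst_tm \<theta> (\<eta> \<rho> n)"]
      split: nat.split)

lemma subst_fm_subst_fm:
  "subst_fm \<theta> (subst_fm \<eta> \<phi>) = subst_fm (\<lambda>\<rho> n. subst_tm \<theta> (\<eta> \<rho> n)) \<phi>"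
  by (induction \<phi> arbitrary: \<theta> \<eta>) (auto simp: subst_tm_subst_tm up_comp)

text \<open>
  The substitution behind \<open>inst\<close>, named so that the laws for substitutions apply to instantiation.
\<close>

definition inst_sub :: "ty \<Rightarrow> tm \<Rightarrow> subst" where
  "inst_sub \<sigma> t = (\<lambda>\<rho> n. if \<rho> = \<sigma> then (case n of 0 \<Rightarrow> t | Suc m \<Rightarrow> Var \<sigma> m) else Var \<rho> n)"

lemma inst_eq: "inst \<sigma> t = subst_fm (inst_sub \<sigma> t)"
  by (simp add: inst_def inst_sub_def)

lemma typed_inst_sub [simp]: "has_ty t \<sigma> \<Longrightarrow> typed (inst_sub \<sigma> t)"
  by (auto simp: typed_def inst_sub_def split: nat.split)

lemma inst_sub_0 [simp]: "inst_sub \<sigma> t \<sigma> 0 = t"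
  by (simp add: inst_sub_def)

lemma inst_sub_Suc [simp]: "inst_sub \<sigma> t \<sigma> (Suc n) = Var \<sigma> n"
  by (simp add: inst_sub_def)

lemma shift_same [simp]: "shift \<sigma> \<sigma> n = Var \<sigma> (Suc n)"
  by (simp add: shift_def)

lemma shift_other [simp]: "\<rho> \<noteq> \<sigma> \<Longrightarrow> shift \<sigma> \<rho> n = Var \<rho> n"
  by (simp add: shift_def)

lemma inst_sub_shift: "(\<lambda>\<rho> n. subst_tm (inst_sub \<sigma> t) (shift \<sigma> \<rho> n)) = Var"
  by (auto simp: fun_eq_iff shift_def inst_sub_def)

lemma inst_lift_tm [simp]: "subst_tm (inst_sub \<sigma> t) (lift_tm \<sigma> s) = s"
  by (simp add: subst_tm_subst_tm inst_sub_shift)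

lemma inst_lift_fm [simp]: "subst_fm (inst_sub \<sigma> t) (lift_fm \<sigma> \<phi>) = \<phi>"
  by (simp add: subst_fm_subst_fm inst_sub_shift)

text \<open>
  Inside the scope of a quantifier rule a quantified assumption appears lifted.  Instantiating it with
  the fresh variable gives back its original body, which is why bodies can be compared directly.
\<close>

lemma inst_Var_up_shift [simp]:
  "subst_fm (inst_sub \<sigma> (Var \<sigma> 0)) (subst_fm (up \<sigma> (shift \<sigma>)) \<phi>) = \<phi>"
proof -
  have "(\<lambda>\<rho> n. subst_tm (inst_sub \<sigma> (Var \<sigma> 0)) (up \<sigma> (shift \<sigma>) \<rho> n)) = Var"
    by (auto simp: fun_eq_iff up_def shift_def inst_sub_def split: nat.split)
  then show ?thesis by (simp add: subst_fm_subst_fm)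
qed

lemma subst_ext_eq [simp]:
  "subst_fm \<theta> (ext_eq \<sigma> s t) = ext_eq \<sigma> (subst_tm \<theta> s) (subst_tm \<theta> t)"
  by (induction \<sigma> s t arbitrary: \<theta> rule: ext_eq.induct) auto

lemma wf_ext_eq [simp]: "has_ty s \<sigma> \<Longrightarrow> has_ty t \<sigma> \<Longrightarrow> wf_fm (ext_eq \<sigma> s t)"
  by (induction \<sigma> s t rule: ext_eq.induct) auto

section \<open>Derived rules of natural deduction\<close>

lemma nd_mono: "nd A \<Gamma> \<phi> \<Longrightarrow> \<Gamma> \<subseteq> \<Delta> \<Longrightarrow> nd A \<Delta> \<phi>"
proof (induction arbitrary: \<Delta> rule: nd.induct)
  case (DisjE \<Gamma> \<phi> \<psi> \<chi>)
  then show ?case by (meson nd.DisjE insert_mono)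
next
  case (ImpI \<phi> \<Gamma> \<psi>)
  then show ?case by (meson nd.ImpI insert_mono)
next
  case (AllI \<sigma> \<Gamma> \<phi>)
  then show ?case by (meson nd.AllI image_mono)
next
  case (ExE \<Gamma> \<sigma> \<phi> \<psi>)
  then show ?case by (meson nd.ExE image_mono insert_mono)
qed (blast intro: nd.intros)+

lemma nd_wf: "nd A \<Gamma> \<phi> \<Longrightarrow> wf_fm \<phi>"
  by (induction rule: nd.induct) (auto simp: inst_eq)

lemma nd_cut: "nd A \<Gamma> \<phi> \<Longrightarrow> nd A (insert \<phi> \<Gamma>) \<psi> \<Longrightarrow> nd A \<Gamma> \<psi>"
  by (blast intro: nd.ImpI nd.ImpE nd_wf)

text \<open>
  Contexts behave like the worlds of a Kripke model: an implication holds in \<open>\<Gamma>\<close> as soon as its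
  conclusion is provable wherever its premise is, in every larger context.  Propositional reasoning
  can thus be done in the metalogic, without naming the assumptions of a derivation.
\<close>

lemma nd_ImpI:
  assumes "wf_fm \<phi>" "\<And>\<Delta>. \<Gamma> \<subseteq> \<Delta> \<Longrightarrow> nd A \<Delta> \<phi> \<Longrightarrow> nd A \<Delta> \<psi>"
  shows "nd A \<Gamma> (Imp \<phi> \<psi>)"
  using assms by (auto intro!: nd.ImpI intro: nd.Asm)

lemma nd_IffI:
  assumes "wf_fm \<phi>" "wf_fm \<psi>"
    and "\<And>\<Delta>. \<Gamma> \<subseteq> \<Delta> \<Longrightarrow> nd A \<Delta> \<phi> \<Longrightarrow> nd A \<Delta> \<psi>"
    and "\<And>\<Delta>. \<Gamma> \<subseteq> \<Delta> \<Longrightarrow> nd A \<Delta> \<psi> \<Longrightarrow> nd A \<Delta> \<phi>"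
  shows "nd A \<Gamma> (Iff \<phi> \<psi>)"
  using assms by (auto intro!: nd.ConjI nd_ImpI)

lemma nd_IffD1: "nd A \<Gamma> (Iff \<phi> \<psi>) \<Longrightarrow> nd A \<Gamma> \<phi> \<Longrightarrow> nd A \<Gamma> \<psi>"
  by (rule nd.ImpE[OF nd.ConjE1])

lemma nd_IffD2: "nd A \<Gamma> (Iff \<phi> \<psi>) \<Longrightarrow> nd A \<Gamma> \<psi> \<Longrightarrow> nd A \<Gamma> \<phi>"
  by (rule nd.ImpE[OF nd.ConjE2])

lemma nd_Conj: "nd A \<Gamma> (Conj \<phi> \<psi>) \<longleftrightarrow> nd A \<Gamma> \<phi> \<and> nd A \<Gamma> \<psi>"
  using nd.ConjI nd.ConjE1 nd.ConjE2 by metis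

lemma nd_AllE: "nd A \<Gamma> (All \<sigma> \<phi>) \<Longrightarrow> has_ty t \<sigma> \<Longrightarrow> nd A \<Gamma> (subst_fm (inst_sub \<sigma> t) \<phi>)"
  using nd.AllE[of A \<Gamma> \<sigma> \<phi> t] by (simp add: inst_eq)

lemma nd_ExI: "nd A \<Gamma> (subst_fm (inst_sub \<sigma> t) \<phi>) \<Longrightarrow> has_ty t \<sigma> \<Longrightarrow> nd A \<Gamma> (Ex \<sigma> \<phi>)"
  using nd.ExI[of A \<Gamma> \<sigma> t \<phi>] by (simp add: inst_eq)

lemma nd_Ex_mono:
  assumes "nd A \<Gamma> (Ex \<sigma> \<phi>)" "nd A (insert \<phi> (lift_fm \<sigma> ` \<Gamma>)) \<psi>"
  shows "nd A \<Gamma> (Ex \<sigma> \<psi>)"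
  using assms(1)
proof (rule nd.ExE)
  show "nd A (insert \<phi> (lift_fm \<sigma> ` \<Gamma>)) (lift_fm \<sigma> (Ex \<sigma> \<psi>))"
    using assms(2) by (auto intro!: nd_ExI[where t = "Var \<sigma> 0"])
qed

abbreviation (input) AllStd :: "fm \<Rightarrow> fm" where
  "AllStd \<phi> \<equiv> All Base (Imp (St Base (Var Base 0)) \<phi>)"

abbreviation (input) ExStd :: "fm \<Rightarrow> fm" where
  "ExStd \<phi> \<equiv> Ex Base (Conj (St Base (Var Base 0)) \<phi>)"

abbreviation std_ctx :: "fm set \<Rightarrow> fm set" where
  "std_ctx \<Gamma> \<equiv> insert (St Base (Var Base 0)) (lift_fm Base ` \<Gamma>)"

lemma AllStdI: "nd A (std_ctx \<Gamma>) \<phi> \<Longrightarrow> nd A \<Gamma> (AllStd \<phi>)"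
  by (rule nd.AllI, rule nd.ImpI) auto

lemma AllStdE:
  assumes "nd A \<Gamma> (AllStd \<phi>)" "has_ty t Base" "nd A \<Gamma> (St Base t)"
  shows "nd A \<Gamma> (subst_fm (inst_sub Base t) \<phi>)"
  using nd_AllE[OF assms(1,2)] assms(3) by (auto intro: nd.ImpE)

lemma ExStdI:
  assumes "nd A \<Gamma> (subst_fm (inst_sub Base t) \<phi>)" "has_ty t Base" "nd A \<Gamma> (St Base t)"
  shows "nd A \<Gamma> (ExStd \<phi>)"
  using assms by (auto intro!: nd_ExI[where t = t] nd.ConjI)

lemma ExStdE:
  assumes "nd A \<Gamma> (ExStd \<phi>)" "nd A (insert \<phi> (std_ctx \<Gamma>)) (lift_fm Base \<psi>)"
  shows "nd A \<Gamma> \<psi>"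
  using assms(1)
proof (rule nd.ExE)
  let ?c = "Conj (St Base (Var Base 0)) \<phi>"
  let ?\<Delta> = "insert ?c (lift_fm Base ` \<Gamma>)"
  have "wf_fm ?c" using nd_wf[OF assms(1)] by simp
  then have c: "nd A ?\<Delta> ?c" by (intro nd.Asm) auto
  have "nd A (insert \<phi> (insert (St Base (Var Base 0)) ?\<Delta>)) (lift_fm Base \<psi>)"
    by (rule nd_mono[OF assms(2)]) auto
  moreover have "nd A (insert (St Base (Var Base 0)) ?\<Delta>) \<phi>"
    using nd.ConjE2[OF c] by (rule nd_mono) auto
  ultimately have "nd A (insert (St Base (Var Base 0)) ?\<Delta>) (lift_fm Base \<psi>)"
    by (rule nd_cut[rotated])
  with nd.ConjE1[OF c] show "nd A ?\<Delta> (lift_fm Base \<psi>)" by (rule nd_cut)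
qed

lemma All_Imp:
  assumes "nd A (lift_fm \<sigma> ` \<Gamma>) (Imp \<phi> \<psi>)"
  shows "nd A \<Gamma> (Imp (All \<sigma> \<phi>) (All \<sigma> \<psi>))"
proof (rule nd.ImpI)
  let ?\<Delta> = "insert (All \<sigma> \<phi>) \<Gamma>"
  from nd_wf[OF assms] show wf: "wf_fm (All \<sigma> \<phi>)" by simp
  then have "nd A (lift_fm \<sigma> ` ?\<Delta>) (All \<sigma> (subst_fm (up \<sigma> (shift \<sigma>)) \<phi>))"
    by (intro nd.Asm) auto
  from nd_AllE[OF this, of "Var \<sigma> 0"] have "nd A (lift_fm \<sigma> ` ?\<Delta>) \<phi>" by simp
  moreover have "nd A (lift_fm \<sigma> ` ?\<Delta>) (Imp \<phi> \<psi>)"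
    by (rule nd_mono[OF assms]) auto
  ultimately have "nd A (lift_fm \<sigma> ` ?\<Delta>) \<psi>" by (rule nd.ImpE[rotated])
  then show "nd A ?\<Delta> (All \<sigma> \<psi>)" by (rule nd.AllI)
qed

lemma Ex_Imp:
  assumes "nd A (lift_fm \<sigma> ` \<Gamma>) (Imp \<phi> \<psi>)"
  shows "nd A \<Gamma> (Imp (Ex \<sigma> \<phi>) (Ex \<sigma> \<psi>))"
proof (rule nd.ImpI)
  let ?\<Delta> = "insert (Ex \<sigma> \<phi>) \<Gamma>"
  from nd_wf[OF assms] show wf: "wf_fm (Ex \<sigma> \<phi>)" by simp
  have "nd A (insert \<phi> (lift_fm \<sigma> ` ?\<Delta>)) (Imp \<phi> \<psi>)"
    by (rule nd_mono[OF assms]) auto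
  moreover have "nd A (insert \<phi> (lift_fm \<sigma> ` ?\<Delta>)) \<phi>"
    using wf by (intro nd.Asm) auto
  ultimately have "nd A (insert \<phi> (lift_fm \<sigma> ` ?\<Delta>)) \<psi>" by (rule nd.ImpE)
  then show "nd A ?\<Delta> (Ex \<sigma> \<psi>)"
    using wf by (intro nd_Ex_mono[OF nd.Asm]) auto
qed

lemma AllStd_Imp:
  assumes "nd A (std_ctx \<Gamma>) (Imp \<phi> \<psi>)"
  shows "nd A \<Gamma> (Imp (AllStd \<phi>) (AllStd \<psi>))"
proof (rule All_Imp, rule nd_ImpI)
  fix \<Delta>
  let ?s = "St Base (Var Base 0)"
  assume \<Delta>: "lift_fm Base ` \<Gamma> \<subseteq> \<Delta>" and h: "nd A \<Delta> (Imp ?s \<phi>)"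
  show "nd A \<Delta> (Imp ?s \<psi>)"
  proof (rule nd.ImpI)
    have "nd A (insert ?s \<Delta>) ?s" by (auto intro: nd.Asm)
    moreover have "nd A (insert ?s \<Delta>) (Imp ?s \<phi>)" using h by (rule nd_mono) auto
    moreover have "nd A (insert ?s \<Delta>) (Imp \<phi> \<psi>)"
      by (rule nd_mono[OF assms]) (use \<Delta> in auto)
    ultimately show "nd A (insert ?s \<Delta>) \<psi>" by (metis nd.ImpE)
  qed simp
qed (use nd_wf[OF assms] in simp)

lemma ExStd_Imp:
  assumes "nd A (std_ctx \<Gamma>) (Imp \<phi> \<psi>)"
  shows "nd A \<Gamma> (Imp (ExStd \<phi>) (ExStd \<psi>))"
proof (rule Ex_Imp, rule nd_ImpI)
  fix \<Delta>
  let ?s = "St Base (Var Base 0)"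
  assume \<Delta>: "lift_fm Base ` \<Gamma> \<subseteq> \<Delta>" and h: "nd A \<Delta> (Conj ?s \<phi>)"
  have "nd A (insert ?s \<Delta>) (Imp \<phi> \<psi>)"
    by (rule nd_mono[OF assms]) (use \<Delta> in auto)
  with h have "nd A \<Delta> (Imp \<phi> \<psi>)" unfolding nd_Conj by (metis nd_cut)
  with h show "nd A \<Delta> (Conj ?s \<psi>)" unfolding nd_Conj by (metis nd.ImpE)
qed (use nd_wf[OF assms] in simp)

lemma Iff_mono: "nd A \<Gamma> (Iff \<phi> \<psi>) \<Longrightarrow> \<Gamma> \<subseteq> \<Delta> \<Longrightarrow> nd A \<Delta> \<phi> = nd A \<Delta> \<psi>"
  by (rule iffI; erule nd_IffD1[OF nd_mono] nd_IffD2[OF nd_mono])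

lemma AllStd_cong:
  assumes "nd A (std_ctx \<Gamma>) (Iff \<phi> \<psi>)"
  shows "nd A \<Gamma> (Iff (AllStd \<phi>) (AllStd \<psi>))"
  by (rule nd.ConjI; rule AllStd_Imp; rule assms[THEN nd.ConjE1] assms[THEN nd.ConjE2])

lemma ExStd_cong:
  assumes "nd A (std_ctx \<Gamma>) (Iff \<phi> \<psi>)"
  shows "nd A \<Gamma> (Iff (ExStd \<phi>) (ExStd \<psi>))"
  by (rule nd.ConjI; rule ExStd_Imp; rule assms[THEN nd.ConjE1] assms[THEN nd.ConjE2])

lemma Conj_cong:
  assumes \<phi>: "nd A \<Gamma> (Iff \<phi> \<phi>')" and \<psi>: "nd A \<Gamma> (Iff \<psi> \<psi>')"
  shows "nd A \<Gamma> (Iff (Conj \<phi> \<psi>) (Conj \<phi>' \<psi>'))"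
proof (rule nd_IffI)
  fix \<Delta> assume "\<Gamma> \<subseteq> \<Delta>"
  then have "nd A \<Delta> \<phi> = nd A \<Delta> \<phi>'" "nd A \<Delta> \<psi> = nd A \<Delta> \<psi>'"
    using Iff_mono[OF \<phi>] Iff_mono[OF \<psi>] by blast+
  then show "nd A \<Delta> (Conj \<phi> \<psi>) \<Longrightarrow> nd A \<Delta> (Conj \<phi>' \<psi>')" "nd A \<Delta> (Conj \<phi>' \<psi>') \<Longrightarrow> nd A \<Delta> (Conj \<phi> \<psi>)"
    by (simp_all add: nd_Conj)
qed (use nd_wf[OF \<phi>] nd_wf[OF \<psi>] in auto)

lemma Disj_cong:
  assumes \<phi>: "nd A \<Gamma> (Iff \<phi> \<phi>')" and \<psi>: "nd A \<Gamma> (Iff \<psi> \<psi>')"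
  shows "nd A \<Gamma> (Iff (Disj \<phi> \<psi>) (Disj \<phi>' \<psi>'))"
proof (rule nd_IffI)
  have wf: "wf_fm \<phi>" "wf_fm \<phi>'" "wf_fm \<psi>" "wf_fm \<psi>'" using nd_wf[OF \<phi>] nd_wf[OF \<psi>] by auto
  then show "wf_fm (Disj \<phi> \<psi>)" "wf_fm (Disj \<phi>' \<psi>')" by auto
  fix \<Delta> assume \<Delta>: "\<Gamma> \<subseteq> \<Delta>"
  have iff: "nd A (insert \<chi> \<Delta>) \<phi> = nd A (insert \<chi> \<Delta>) \<phi>'" "nd A (insert \<chi> \<Delta>) \<psi> = nd A (insert \<chi> \<Delta>) \<psi>'" for \<chi>
    by (rule Iff_mono[OF \<phi>] Iff_mono[OF \<psi>], use \<Delta> in blast)+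
  have asm: "nd A (insert \<chi> \<Delta>) \<chi>" if "wf_fm \<chi>" for \<chi> using that by (intro nd.Asm) auto
  show "nd A \<Delta> (Disj \<phi>' \<psi>')" if "nd A \<Delta> (Disj \<phi> \<psi>)"
    using that
  proof (rule nd.DisjE)
    show "nd A (insert \<phi> \<Delta>) (Disj \<phi>' \<psi>')"
      by (rule nd.DisjI1[OF iff(1)[THEN iffD1, OF asm]]) fact+
    show "nd A (insert \<psi> \<Delta>) (Disj \<phi>' \<psi>')"
      by (rule nd.DisjI2[OF iff(2)[THEN iffD1, OF asm]]) fact+
  qed
  show "nd A \<Delta> (Disj \<phi> \<psi>)" if "nd A \<Delta> (Disj \<phi>' \<psi>')"
    using that
  proof (rule nd.DisjE)
    show "nd A (insert \<phi>' \<Delta>) (Disj \<phi> \<psi>)"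
      by (rule nd.DisjI1[OF iff(1)[THEN iffD2, OF asm]]) fact+
    show "nd A (insert \<psi>' \<Delta>) (Disj \<phi> \<psi>)"
      by (rule nd.DisjI2[OF iff(2)[THEN iffD2, OF asm]]) fact+
  qed
qed

lemma Imp_cong:
  assumes \<phi>: "nd A \<Gamma> (Iff \<phi> \<phi>')" and \<psi>: "nd A \<Gamma> (Iff \<psi> \<psi>')"
  shows "nd A \<Gamma> (Iff (Imp \<phi> \<psi>) (Imp \<phi>' \<psi>'))"
proof -
  have wf: "wf_fm \<phi>" "wf_fm \<phi>'" "wf_fm \<psi>" "wf_fm \<psi>'" using nd_wf[OF \<phi>] nd_wf[OF \<psi>] by auto
  have imp: "nd A \<Delta> (Imp \<beta> \<beta>')"
    if h: "nd A \<Delta> (Imp \<alpha> \<alpha>')" and "wf_fm \<beta>"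
      and iff: "\<And>\<Delta>'. \<Delta> \<subseteq> \<Delta>' \<Longrightarrow> nd A \<Delta>' \<beta> = nd A \<Delta>' \<alpha> \<and> nd A \<Delta>' \<beta>' = nd A \<Delta>' \<alpha>'"
    for \<alpha> \<alpha>' \<beta> \<beta>' \<Delta>
  proof (rule nd_ImpI)
    fix \<Delta>' assume \<Delta>': "\<Delta> \<subseteq> \<Delta>'" and "nd A \<Delta>' \<beta>"
    then have "nd A \<Delta>' \<alpha>" using iff by blast
    with nd_mono[OF h \<Delta>'] have "nd A \<Delta>' \<alpha>'" by (rule nd.ImpE)
    then show "nd A \<Delta>' \<beta>'" using iff \<Delta>' by blast
  qed fact
  show ?thesis
  proof (rule nd_IffI)
    fix \<Delta> assume \<Delta>: "\<Gamma> \<subseteq> \<Delta>"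
    note iffs = Iff_mono[OF \<phi> order_trans[OF \<Delta>]] Iff_mono[OF \<psi> order_trans[OF \<Delta>]]
    show "nd A \<Delta> (Imp \<phi>' \<psi>')" if "nd A \<Delta> (Imp \<phi> \<psi>)"
      by (rule imp[OF that wf(2)]) (simp add: iffs)
    show "nd A \<Delta> (Imp \<phi> \<psi>)" if "nd A \<Delta> (Imp \<phi>' \<psi>')"
      by (rule imp[OF that wf(1)]) (simp add: iffs)
  qed (use wf in auto)
qed

text \<open>
  A domain that is the whole type is defined by a true formula.  The following rules remove such a
  domain formula from the quantifiers that are relativized to it.
\<close>

lemma nd_trivial: "nd A \<Gamma> (Imp Fls Fls)"
  by (rule nd.ImpI, rule nd.Asm) auto

lemma trivial_guard:
  assumes "wf_fm \<phi>"
  shows "nd A \<Gamma> (Iff (Imp (Imp Fls Fls) \<phi>) \<phi>)" "nd A \<Gamma> (Iff (Conj (Imp Fls Fls) \<phi>) \<phi>)"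
proof -
  show "nd A \<Gamma> (Iff (Imp (Imp Fls Fls) \<phi>) \<phi>)"
  proof (rule nd_IffI)
    show "nd A \<Delta> (Imp (Imp Fls Fls) \<phi>) \<Longrightarrow> nd A \<Delta> \<phi>" for \<Delta>
      by (rule nd.ImpE[OF _ nd_trivial])
    show "nd A \<Delta> \<phi> \<Longrightarrow> nd A \<Delta> (Imp (Imp Fls Fls) \<phi>)" for \<Delta>
      by (rule nd.ImpI, erule nd_mono) auto
  qed (use assms in auto)
  show "nd A \<Gamma> (Iff (Conj (Imp Fls Fls) \<phi>) \<phi>)"
    using assms by (intro nd_IffI) (auto simp: nd_Conj nd_trivial)
qed

lemma Iff_trans:
  assumes "nd A \<Gamma> (Iff \<phi> \<psi>)" "nd A \<Gamma> (Iff \<psi> \<chi>)"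
  shows "nd A \<Gamma> (Iff \<phi> \<chi>)"
proof (rule nd_IffI)
  fix \<Delta> assume \<Delta>: "\<Gamma> \<subseteq> \<Delta>"
  show "nd A \<Delta> \<phi> \<Longrightarrow> nd A \<Delta> \<chi>" "nd A \<Delta> \<chi> \<Longrightarrow> nd A \<Delta> \<phi>"
    unfolding Iff_mono[OF assms(1) \<Delta>] Iff_mono[OF assms(2) \<Delta>] .
qed (use nd_wf[OF assms(1)] nd_wf[OF assms(2)] in auto)

lemma All_trivial_guard:
  assumes "nd A (lift_fm \<sigma> ` \<Gamma>) (Iff \<phi> \<psi>)"
  shows "nd A \<Gamma> (Iff (All \<sigma> (Imp (Imp Fls Fls) \<phi>)) (All \<sigma> \<psi>))"
proof -
  have "wf_fm \<phi>" using nd_wf[OF assms] by simp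
  note iff = Iff_trans[OF trivial_guard(1)[OF this] assms]
  show ?thesis
    by (rule nd.ConjI; rule All_Imp; rule iff[THEN nd.ConjE1] iff[THEN nd.ConjE2])
qed

lemma Ex_trivial_guard:
  assumes "nd A (lift_fm \<sigma> ` \<Gamma>) (Iff \<phi> \<psi>)"
  shows "nd A \<Gamma> (Iff (Ex \<sigma> (Conj (Imp Fls Fls) \<phi>)) (Ex \<sigma> \<psi>))"
proof -
  have "wf_fm \<phi>" using nd_wf[OF assms] by simp
  note iff = Iff_trans[OF trivial_guard(2)[OF this] assms]
  show ?thesis
    by (rule nd.ConjI; rule Ex_Imp; rule iff[THEN nd.ConjE1] iff[THEN nd.ConjE2])
qed

lemma Iff_refl: "wf_fm \<phi> \<Longrightarrow> nd A \<Gamma> (Iff \<phi> \<phi>)"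
  by (rule nd_IffI)

section \<open>Addition and multiplication in Goedel's T\<close>

abbreviation Fun :: ty where "Fun \<equiv> Base \<rightarrow> Base"

text \<open>
  A recursor calls its step function with the previous value and the current argument.  For plain
  iteration of \<open>g\<close> the step must discard the latter, so it is \<open>\<lambda>y n. g y\<close>, in combinators \<open>S (K K) g\<close>.
\<close>

definition iter_step :: "tm \<Rightarrow> tm" where
  "iter_step g = App (App (Comb Base Base Fun) (App (Proj (Base \<rightarrow> Fun) Base) (Proj Base Base))) g"

definition iter :: "tm \<Rightarrow> tm \<Rightarrow> tm \<Rightarrow> tm" where
  "iter g s t = App (App (App (Rec Base) s) (iter_step g)) t"

definition plus :: "tm \<Rightarrow> tm \<Rightarrow> tm" where
  "plus s t = iter Succ s t"

text \<open>
  The function \<open>\<lambda>x. x + s\<close> in combinators, that is, \<open>S (S R (K step)) (K s)\<close>, where \<open>R x step s\<close> computes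
  \<open>x + s\<close>.  It is this function, rather than \<open>\<lambda>x. s + x\<close>, whose iteration satisfies the recursion
  equation \<open>s * (t + 1) = s * t + s\<close> without commutativity of addition.
\<close>

definition plus_arg :: "tm \<Rightarrow> tm" where
  "plus_arg s = App (App (Comb Base Base Base)
     (App (App (Comb Base (Base \<rightarrow> Fun) Fun) (Rec Base)) (App (Proj (Base \<rightarrow> Fun) Base) (iter_step Succ))))
     (App (Proj Base Base) s)"

definition times :: "tm \<Rightarrow> tm \<Rightarrow> tm" where
  "times s t = iter (plus_arg s) Zero t"

lemma subst_iter_step [simp]: "subst_tm \<theta> (iter_step g) = iter_step (subst_tm \<theta> g)"
  by (simp add: iter_step_def)

lemma subst_plus_arg [simp]: "subst_tm \<theta> (plus_arg s) = plus_arg (subst_tm \<theta> s)"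
  by (simp add: plus_arg_def)

lemma subst_plus [simp]: "subst_tm \<theta> (plus s t) = plus (subst_tm \<theta> s) (subst_tm \<theta> t)"
  by (simp add: plus_def iter_def)

lemma subst_times [simp]: "subst_tm \<theta> (times s t) = times (subst_tm \<theta> s) (subst_tm \<theta> t)"
  by (simp add: times_def iter_def)

lemma ty_iter_step [simp]:
  "well_typed g \<Longrightarrow> ty_of g = Fun \<Longrightarrow> well_typed (iter_step g)"
  "ty_of (iter_step g) = Base \<rightarrow> Fun"
  by (auto simp: iter_step_def)

lemma ty_plus_arg [simp]:
  "well_typed s \<Longrightarrow> ty_of s = Base \<Longrightarrow> well_typed (plus_arg s)" "ty_of (plus_arg s) = Fun"
  by (auto simp: plus_arg_def)

lemma ty_iter [simp]:
  "well_typed g \<Longrightarrow> ty_of g = Fun \<Longrightarrow> well_typed s \<Longrightarrow> ty_of s = Base \<Longrightarrow> well_typed t \<Longrightarrow>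
    ty_of t = Base \<Longrightarrow> well_typed (iter g s t)"
  "ty_of (iter g s t) = Base"
  by (auto simp: iter_def)

lemma ty_plus [simp]:
  "well_typed s \<Longrightarrow> ty_of s = Base \<Longrightarrow> well_typed t \<Longrightarrow> ty_of t = Base \<Longrightarrow> well_typed (plus s t)"
  "ty_of (plus s t) = Base"
  by (auto simp: plus_def)

lemma ty_times [simp]:
  "well_typed s \<Longrightarrow> ty_of s = Base \<Longrightarrow> well_typed t \<Longrightarrow> ty_of t = Base \<Longrightarrow> well_typed (times s t)"
  "ty_of (times s t) = Base"
  by (auto simp: times_def)

lemma fv_plus [simp]: "fv_tm (plus s t) = fv_tm s \<union> fv_tm t"
  by (simp add: plus_def iter_def iter_step_def)

lemma fv_times [simp]: "fv_tm (times s t) = fv_tm s \<union> fv_tm t"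
  by (auto simp: times_def iter_def iter_step_def plus_arg_def)

locale saturated_arithmetic =
  fixes A :: "fm set"
  assumes EHA: "EHA \<subseteq> A"
    and ST: "ST \<subseteq> A"
    and LEM: "LEM \<subseteq> A"
    and CSAT0: "CSAT0 \<subseteq> A"
begin

abbreviation prov :: "fm set \<Rightarrow> fm \<Rightarrow> bool"  (infix "\<turnstile>" 40) where
  "\<Gamma> \<turnstile> \<phi> \<equiv> nd A \<Gamma> \<phi>"

lemma EHA_ax: "\<phi> \<in> EHA \<Longrightarrow> wf_fm \<phi> \<Longrightarrow> \<Gamma> \<turnstile> \<phi>"
  using EHA by (auto intro: nd.Ax)

lemma ST_ax: "\<phi> \<in> ST \<Longrightarrow> wf_fm \<phi> \<Longrightarrow> \<Gamma> \<turnstile> \<phi>"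
  using ST by (auto intro: nd.Ax)

lemma Eq_refl: "has_ty t Base \<Longrightarrow> \<Gamma> \<turnstile> Eq t t"
  by (intro EHA_ax EHA.eq_refl) auto

lemma Eq_sym:
  assumes "\<Gamma> \<turnstile> Eq s t"
  shows "\<Gamma> \<turnstile> Eq t s"
proof -
  have "\<Gamma> \<turnstile> Imp (Eq s t) (Eq t s)"
    using nd_wf[OF assms] by (intro EHA_ax EHA.eq_sym) auto
  from this assms show ?thesis by (rule nd.ImpE)
qed

lemma Eq_trans [trans]:
  assumes "\<Gamma> \<turnstile> Eq r s" "\<Gamma> \<turnstile> Eq s t"
  shows "\<Gamma> \<turnstile> Eq r t"
proof -
  have "\<Gamma> \<turnstile> Imp (Conj (Eq r s) (Eq s t)) (Eq r t)"
    using nd_wf[OF assms(1)] nd_wf[OF assms(2)] by (intro EHA_ax EHA.eq_trans) auto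
  with assms show ?thesis by (metis nd.ImpE nd.ConjI)
qed

text \<open>
  Equality at a function type is pointwise equality, so it may be applied to an argument; that
  applying a function preserves equality in the argument is the axiom of extensionality.  All
  computations with combinators combine these two steps until an equation of type 0 is reached.
\<close>

lemma ext_app:
  assumes "\<Gamma> \<turnstile> ext_eq (\<sigma> \<rightarrow> \<tau>) s t" "has_ty u \<sigma>"
  shows "\<Gamma> \<turnstile> ext_eq \<tau> (App s u) (App t u)"
  using nd_AllE[OF assms[unfolded ext_eq.simps]] by simp

lemma ext_cong:
  assumes "\<Gamma> \<turnstile> ext_eq \<sigma> s t" "has_ty r (\<sigma> \<rightarrow> \<tau>)" "has_ty s \<sigma>" "has_ty t \<sigma>"
  shows "\<Gamma> \<turnstile> ext_eq \<tau> (App r s) (App r t)"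
proof -
  have "\<Gamma> \<turnstile> Imp (ext_eq \<sigma> s t) (ext_eq \<tau> (App r s) (App r t))"
    using assms by (intro EHA_ax EHA.extensionality) auto
  from this assms(1) show ?thesis by (rule nd.ImpE)
qed

lemma proj_eq: "has_ty s \<sigma> \<Longrightarrow> has_ty t \<tau> \<Longrightarrow> \<Gamma> \<turnstile> ext_eq \<sigma> (App (App (Proj \<sigma> \<tau>) s) t) s"
  by (intro EHA_ax EHA.proj) auto

lemma comb_eq:
  assumes "has_ty r (\<rho> \<rightarrow> \<sigma> \<rightarrow> \<tau>)" "has_ty s (\<rho> \<rightarrow> \<sigma>)" "has_ty t \<rho>"
  shows "\<Gamma> \<turnstile> ext_eq \<tau> (App (App (App (Comb \<rho> \<sigma> \<tau>) r) s) t) (App (App r t) (App s t))"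
  using assms by (intro EHA_ax EHA.comb) auto

lemma iter_step_eq:
  assumes "has_ty g Fun" "has_ty y Base" "has_ty n Base"
  shows "\<Gamma> \<turnstile> Eq (App (App (iter_step g) y) n) (App g y)"
proof -
  let ?K = "Proj Base Base" and ?KK = "App (Proj (Base \<rightarrow> Fun) Base) (Proj Base Base)"
  have "\<Gamma> \<turnstile> ext_eq Fun (App (iter_step g) y) (App (App ?KK y) (App g y))"
    unfolding iter_step_def using assms by (intro comb_eq) auto
  from ext_app[OF this assms(3)]
  have 1: "\<Gamma> \<turnstile> Eq (App (App (iter_step g) y) n) (App (App (App ?KK y) (App g y)) n)" by simp
  have "\<Gamma> \<turnstile> ext_eq (Base \<rightarrow> Fun) (App ?KK y) ?K" using assms by (intro proj_eq) auto
  from ext_app[OF ext_app[OF this, of "App g y"], of n] assms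
  have 2: "\<Gamma> \<turnstile> Eq (App (App (App ?KK y) (App g y)) n) (App (App ?K (App g y)) n)" by simp
  have "\<Gamma> \<turnstile> ext_eq Base (App (App ?K (App g y)) n) (App g y)" using assms by (intro proj_eq) auto
  then have 3: "\<Gamma> \<turnstile> Eq (App (App ?K (App g y)) n) (App g y)" by simp
  from Eq_trans[OF Eq_trans[OF 1 2] 3] show ?thesis .
qed

lemma iter_Zero:
  assumes "has_ty g Fun" "has_ty s Base"
  shows "\<Gamma> \<turnstile> Eq (iter g s Zero) s"
proof -
  have "\<Gamma> \<turnstile> ext_eq Base (iter g s Zero) s"
    unfolding iter_def using assms by (intro EHA_ax EHA.rec_zero) auto
  then show ?thesis by simp
qed

lemma iter_Succ:
  assumes "has_ty g Fun" "has_ty s Base" "has_ty t Base"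
  shows "\<Gamma> \<turnstile> Eq (iter g s (App Succ t)) (App g (iter g s t))"
proof -
  have "\<Gamma> \<turnstile> ext_eq Base (iter g s (App Succ t)) (App (App (iter_step g) (iter g s t)) t)"
    unfolding iter_def using assms by (intro EHA_ax EHA.rec_succ) auto
  moreover have "\<Gamma> \<turnstile> Eq (App (App (iter_step g) (iter g s t)) t) (App g (iter g s t))"
    using assms by (intro iter_step_eq) (auto simp: iter_def)
  ultimately show ?thesis by (simp add: Eq_trans)
qed

lemma plus_arg_eq:
  assumes s: "has_ty s Base" and x: "has_ty x Base"
  shows "\<Gamma> \<turnstile> Eq (App (plus_arg s) x) (plus x s)"
proof -
  let ?step = "iter_step Succ"
  let ?Kstep = "App (Proj (Base \<rightarrow> Fun) Base) ?step" and ?Ks = "App (Proj Base Base) s"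
  let ?R = "App (Rec Base) x"
  let ?L = "App (App (Comb Base (Base \<rightarrow> Fun) Fun) (Rec Base)) ?Kstep"
  have "\<Gamma> \<turnstile> ext_eq Base (App (plus_arg s) x) (App (App ?L x) (App ?Ks x))"
    unfolding plus_arg_def using s x by (intro comb_eq) auto
  then have 1: "\<Gamma> \<turnstile> Eq (App (plus_arg s) x) (App (App ?L x) (App ?Ks x))" by simp
  have "\<Gamma> \<turnstile> ext_eq Fun (App ?L x) (App ?R (App ?Kstep x))"
    using x by (intro comb_eq) auto
  from ext_app[OF this, of "App ?Ks x"] s x
  have 2: "\<Gamma> \<turnstile> Eq (App (App ?L x) (App ?Ks x)) (App (App ?R (App ?Kstep x)) (App ?Ks x))" by simp
  \<comment> \<open>The vacuous abstractions over \<open>x\<close> stand in argument positions, where only extensionality can contract them.\<close>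
  have "\<Gamma> \<turnstile> ext_eq (Base \<rightarrow> Fun) (App ?Kstep x) ?step"
    using x by (intro proj_eq) auto
  then have "\<Gamma> \<turnstile> ext_eq Fun (App ?R (App ?Kstep x)) (App ?R ?step)"
    using x by (intro ext_cong) auto
  from ext_app[OF this, of "App ?Ks x"] s x
  have 3: "\<Gamma> \<turnstile> Eq (App (App ?R (App ?Kstep x)) (App ?Ks x)) (App (App ?R ?step) (App ?Ks x))"
    by simp
  have "\<Gamma> \<turnstile> ext_eq Base (App ?Ks x) s" using s x by (intro proj_eq) auto
  then have "\<Gamma> \<turnstile> ext_eq Base (App (App ?R ?step) (App ?Ks x)) (App (App ?R ?step) s)"
    using s x by (intro ext_cong) auto
  then have 4: "\<Gamma> \<turnstile> Eq (App (App ?R ?step) (App ?Ks x)) (plus x s)"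
    by (simp add: plus_def iter_def)
  from Eq_trans[OF Eq_trans[OF Eq_trans[OF 1 2] 3] 4] show ?thesis .
qed

lemma App_cong:
  assumes "\<Gamma> \<turnstile> Eq s t" "has_ty r Fun"
  shows "\<Gamma> \<turnstile> Eq (App r s) (App r t)"
  using ext_cong[of \<Gamma> Base s t r Base] nd_wf[OF assms(1)] assms by simp

lemma iter_cong:
  assumes "\<Gamma> \<turnstile> Eq t t'" "has_ty g Fun" "has_ty s Base"
  shows "\<Gamma> \<turnstile> Eq (iter g s t) (iter g s t')"
  unfolding iter_def using assms by (intro App_cong) auto

lemma plus_cong:
  assumes s: "\<Gamma> \<turnstile> Eq s s'" and t: "\<Gamma> \<turnstile> Eq t t'"
  shows "\<Gamma> \<turnstile> Eq (plus s t) (plus s' t')"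
proof -
  note wf = nd_wf[OF s] nd_wf[OF t]
  have "\<Gamma> \<turnstile> ext_eq ((Base \<rightarrow> Fun) \<rightarrow> Fun) (App (Rec Base) s) (App (Rec Base) s')"
    using s wf by (intro ext_cong) auto
  from ext_app[OF ext_app[OF this, of "iter_step Succ"], of t] wf
  have "\<Gamma> \<turnstile> Eq (plus s t) (plus s' t)" by (simp add: plus_def iter_def)
  moreover have "\<Gamma> \<turnstile> Eq (plus s' t) (plus s' t')"
    unfolding plus_def using t wf by (intro iter_cong) auto
  ultimately show ?thesis by (rule Eq_trans)
qed

text \<open>
  The factor \<open>s\<close> is buried in \<open>plus_arg s\<close>.  Extensionality carries an equation outwards through one
  application at a time, by equalities of higher type, until the outermost argument is supplied.
\<close>

lemma times_cong:
  assumes s: "\<Gamma> \<turnstile> Eq s s'" and t: "\<Gamma> \<turnstile> Eq t t'"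
  shows "\<Gamma> \<turnstile> Eq (times s t) (times s' t')"
proof -
  note wf = nd_wf[OF s] nd_wf[OF t]
  have "\<Gamma> \<turnstile> ext_eq Fun (plus_arg s) (plus_arg s')"
    unfolding plus_arg_def using s wf by (intro ext_cong) auto
  then have "\<Gamma> \<turnstile> ext_eq Fun (App (App (Rec Base) Zero) (iter_step (plus_arg s)))
      (App (App (Rec Base) Zero) (iter_step (plus_arg s')))"
    using wf unfolding iter_step_def by (intro ext_cong) auto
  from ext_app[OF this, of t] wf
  have "\<Gamma> \<turnstile> Eq (times s t) (times s' t)" by (simp add: times_def iter_def)
  moreover have "\<Gamma> \<turnstile> Eq (times s' t) (times s' t')"
    unfolding times_def using t wf by (intro iter_cong) auto
  ultimately show ?thesis by (rule Eq_trans)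
qed

lemma plus_Zero: "has_ty s Base \<Longrightarrow> \<Gamma> \<turnstile> Eq (plus s Zero) s"
  unfolding plus_def by (intro iter_Zero) auto

lemma plus_Succ:
  "has_ty s Base \<Longrightarrow> has_ty t Base \<Longrightarrow> \<Gamma> \<turnstile> Eq (plus s (App Succ t)) (App Succ (plus s t))"
  unfolding plus_def by (intro iter_Succ) auto

lemma times_Zero: "has_ty s Base \<Longrightarrow> \<Gamma> \<turnstile> Eq (times s Zero) Zero"
  unfolding times_def by (intro iter_Zero) auto

lemma times_Succ:
  assumes "has_ty s Base" "has_ty t Base"
  shows "\<Gamma> \<turnstile> Eq (times s (App Succ t)) (plus (times s t) s)"
proof -
  have "\<Gamma> \<turnstile> Eq (times s (App Succ t)) (App (plus_arg s) (times s t))"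
    unfolding times_def using assms by (intro iter_Succ) auto
  also have "\<Gamma> \<turnstile> Eq (App (plus_arg s) (times s t)) (plus (times s t) s)"
    using assms by (intro plus_arg_eq) auto
  finally show ?thesis .
qed

lemma St_closed: "has_ty t \<sigma> \<Longrightarrow> fv_tm t = {} \<Longrightarrow> \<Gamma> \<turnstile> St \<sigma> t"
  by (intro ST_ax ST.st_closed) auto

lemma St_App:
  assumes "\<Gamma> \<turnstile> St (\<sigma> \<rightarrow> \<tau>) s" "\<Gamma> \<turnstile> St \<sigma> t"
  shows "\<Gamma> \<turnstile> St \<tau> (App s t)"
proof -
  have "\<Gamma> \<turnstile> Imp (Conj (St (\<sigma> \<rightarrow> \<tau>) s) (St \<sigma> t)) (St \<tau> (App s t))"
    using nd_wf[OF assms(1)] nd_wf[OF assms(2)] by (intro ST_ax ST.st_app) auto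
  with assms show ?thesis by (metis nd.ImpE nd.ConjI)
qed

lemma St_iter:
  assumes g: "\<Gamma> \<turnstile> St Fun g" and s: "\<Gamma> \<turnstile> St Base s" and t: "\<Gamma> \<turnstile> St Base t"
  shows "\<Gamma> \<turnstile> St Base (iter g s t)"
proof -
  have "\<Gamma> \<turnstile> St (Base \<rightarrow> Fun) (iter_step g)"
    unfolding iter_step_def by (rule St_App[OF St_closed g]) auto
  moreover have "\<Gamma> \<turnstile> St ((Base \<rightarrow> Fun) \<rightarrow> Fun) (App (Rec Base) s)"
    by (rule St_App[OF St_closed s]) auto
  ultimately show ?thesis
    unfolding iter_def using t by (metis St_App)
qed

lemma St_plus: "\<Gamma> \<turnstile> St Base s \<Longrightarrow> \<Gamma> \<turnstile> St Base t \<Longrightarrow> \<Gamma> \<turnstile> St Base (plus s t)"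
  unfolding plus_def by (rule St_iter[OF St_closed]) auto

lemma St_times:
  assumes s: "\<Gamma> \<turnstile> St Base s" and t: "\<Gamma> \<turnstile> St Base t"
  shows "\<Gamma> \<turnstile> St Base (times s t)"
proof -
  have K: "\<Gamma> \<turnstile> St Fun (App (Proj Base Base) s)"
    by (rule St_App[OF St_closed s]) auto
  have "\<Gamma> \<turnstile> St Fun (plus_arg s)"
    unfolding plus_arg_def by (rule St_App[OF St_closed K]) (auto simp: iter_step_def)
  then show ?thesis
    unfolding times_def using t by (intro St_iter[OF _ St_closed]) auto
qed

lemma St_Zero: "\<Gamma> \<turnstile> St Base Zero"
  by (rule St_closed) auto

lemma St_Succ: "\<Gamma> \<turnstile> St Base t \<Longrightarrow> \<Gamma> \<turnstile> St Base (App Succ t)"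
  by (rule St_App[OF St_closed]) auto

lemma AllSt_iff: "wf_fm \<phi> \<Longrightarrow> \<Gamma> \<turnstile> Iff (AllSt Base \<phi>) (AllStd \<phi>)"
  by (intro ST_ax ST.all_st) auto

lemma excluded_middle: "wf_fm \<phi> \<Longrightarrow> \<Gamma> \<turnstile> Disj \<phi> (Neg \<phi>)"
  using LEM by (intro nd.Ax) (auto simp: LEM_def)

lemma classical:
  assumes "insert (Neg \<phi>) \<Gamma> \<turnstile> Fls" "wf_fm \<phi>"
  shows "\<Gamma> \<turnstile> \<phi>"
  using excluded_middle[OF assms(2)]
proof (rule nd.DisjE)
  show "insert \<phi> \<Gamma> \<turnstile> \<phi>" using assms(2) by (intro nd.Asm) auto
  show "insert (Neg \<phi>) \<Gamma> \<turnstile> \<phi>" using assms by (rule nd.FlsE)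
qed

end

section \<open>Translating arithmetical terms by terms\<close>

fun val :: "(nat \<Rightarrow> tm) \<Rightarrow> ntm \<Rightarrow> tm" where
  "val \<nu> (NVar n) = \<nu> n"
| "val \<nu> NZero = Zero"
| "val \<nu> (NSuc t) = App Succ (val \<nu> t)"
| "val \<nu> (NPlus s t) = plus (val \<nu> s) (val \<nu> t)"
| "val \<nu> (NTimes s t) = times (val \<nu> s) (val \<nu> t)"

text \<open>
  The environment below a quantifier over type \<open>\<sigma>\<close>.
\<close>

abbreviation ext :: "ty \<Rightarrow> (nat \<Rightarrow> tm) \<Rightarrow> nat \<Rightarrow> tm" where
  "ext \<sigma> \<nu> \<equiv> case_nat (Var \<sigma> 0) (lift_tm \<sigma> \<circ> \<nu>)"

text \<open>
  This differs from \<open>tr\<close> for the interpretation defined below in that an arithmetical term is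
  translated by a term of type 0 instead of a formula for its graph, and in that set quantifiers
  carry no domain formula.
\<close>

fun relat :: "(nat \<Rightarrow> tm) \<Rightarrow> (nat \<Rightarrow> tm) \<Rightarrow> pfm \<Rightarrow> fm" where
  "relat \<nu> \<mu> PFls = Fls"
| "relat \<nu> \<mu> (PEq s t) = Eq (val \<nu> s) (val \<nu> t)"
| "relat \<nu> \<mu> (PMem t X) = Eq (App (\<mu> X) (val \<nu> t)) Zero"
| "relat \<nu> \<mu> (PConj \<phi> \<psi>) = Conj (relat \<nu> \<mu> \<phi>) (relat \<nu> \<mu> \<psi>)"
| "relat \<nu> \<mu> (PDisj \<phi> \<psi>) = Disj (relat \<nu> \<mu> \<phi>) (relat \<nu> \<mu> \<psi>)"
| "relat \<nu> \<mu> (PImp \<phi> \<psi>) = Imp (relat \<nu> \<mu> \<phi>) (relat \<nu> \<mu> \<psi>)"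
| "relat \<nu> \<mu> (AllN \<phi>) = AllStd (relat (ext Base \<nu>) (lift_tm Base \<circ> \<mu>) \<phi>)"
| "relat \<nu> \<mu> (ExN \<phi>) = ExStd (relat (ext Base \<nu>) (lift_tm Base \<circ> \<mu>) \<phi>)"
| "relat \<nu> \<mu> (AllS \<phi>) = All Fun (relat (lift_tm Fun \<circ> \<nu>) (ext Fun \<mu>) \<phi>)"
| "relat \<nu> \<mu> (ExS \<phi>) = Ex Fun (relat (lift_tm Fun \<circ> \<nu>) (ext Fun \<mu>) \<phi>)"

definition env :: "(nat \<Rightarrow> tm) \<Rightarrow> (nat \<Rightarrow> tm) \<Rightarrow> bool" where
  "env \<nu> \<mu> \<longleftrightarrow> (\<forall>n. has_ty (\<nu> n) Base \<and> has_ty (\<mu> n) Fun)"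

lemma env_ext [simp]:
  "env \<nu> \<mu> \<Longrightarrow> env (ext Base \<nu>) (lift_tm Base \<circ> \<mu>)"
  "env \<nu> \<mu> \<Longrightarrow> env (lift_tm Fun \<circ> \<nu>) (ext Fun \<mu>)"
  by (auto simp: env_def split: nat.split)

lemma ty_val [simp]:
  assumes "env \<nu> \<mu>"
  shows "well_typed (val \<nu> t)" "ty_of (val \<nu> t) = Base"
  using assms by (induction t) (auto simp: env_def)

lemma wf_relat [simp]: "env \<nu> \<mu> \<Longrightarrow> wf_fm (relat \<nu> \<mu> \<phi>)"
proof (induction \<phi> arbitrary: \<nu> \<mu>)
  case (PMem t X)
  then show ?case using ty_val[OF PMem] by (auto simp: env_def)
qed (auto simp del: has_ty_iff simp: has_ty_iff[of "Var _ _"] has_ty_iff[of "val _ _"])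

lemma subst_val [simp]: "subst_tm \<theta> (val \<nu> t) = val (subst_tm \<theta> \<circ> \<nu>) t"
  by (induction t) auto

lemma subst_ext: "subst_tm (up \<sigma> \<theta>) \<circ> ext \<sigma> \<nu> = ext \<sigma> (subst_tm \<theta> \<circ> \<nu>)"
  by (auto simp: fun_eq_iff split: nat.split)

lemma subst_lift: "subst_tm (up \<sigma> \<theta>) \<circ> (lift_tm \<sigma> \<circ> \<mu>) = lift_tm \<sigma> \<circ> (subst_tm \<theta> \<circ> \<mu>)"
  by (auto simp: fun_eq_iff)

text \<open>
  Substitution in the target and, in \<open>relat_subst\<close>, substitution in the source only change the
  environments.  Hence lifting and instantiation in the two languages correspond by equations
  between formulas, and the quantifier rules of one calculus become those of the other.
\<close>

lemma subst_relat [simp]: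
  "subst_fm \<theta> (relat \<nu> \<mu> \<phi>) = relat (subst_tm \<theta> \<circ> \<nu>) (subst_tm \<theta> \<circ> \<mu>) \<phi>"
  by (induction \<phi> arbitrary: \<theta> \<nu> \<mu>) (auto simp: subst_ext subst_lift)

lemma val_subst [simp]: "val \<nu> (subst_ntm \<theta> t) = val (val \<nu> \<circ> \<theta>) t"
  by (induction t) auto

lemma ext_up_num: "val (ext Base \<nu>) \<circ> up_num \<theta> = ext Base (val \<nu> \<circ> \<theta>)"
  by (auto simp: fun_eq_iff up_num_def comp_def split: nat.split)

lemma ext_up_set: "ext Fun \<mu> \<circ> up_set \<xi> = ext Fun (\<mu> \<circ> \<xi>)"
  by (auto simp: fun_eq_iff up_set_def split: nat.split)

lemma lift_val: "val (lift_tm \<sigma> \<circ> \<nu>) \<circ> \<theta> = lift_tm \<sigma> \<circ> (val \<nu> \<circ> \<theta>)"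
  by (auto simp: fun_eq_iff)

lemma relat_subst [simp]:
  "relat \<nu> \<mu> (subst_pfm \<theta> \<xi> \<phi>) = relat (val \<nu> \<circ> \<theta>) (\<mu> \<circ> \<xi>) \<phi>"
  by (induction \<phi> arbitrary: \<nu> \<mu> \<theta> \<xi>)
    (simp_all add: ext_up_num ext_up_set lift_val comp_assoc)

lemma relat_lift_num: "relat (ext Base \<nu>) (lift_tm Base \<circ> \<mu>) (lift_num \<phi>) = lift_fm Base (relat \<nu> \<mu> \<phi>)"
  by (simp add: comp_def)

lemma relat_lift_set: "relat (lift_tm Fun \<circ> \<nu>) (ext Fun \<mu>) (lift_set \<phi>) = lift_fm Fun (relat \<nu> \<mu> \<phi>)"
  by (simp add: comp_def)

lemma inst_sub_ext: "subst_tm (inst_sub \<sigma> t) \<circ> ext \<sigma> \<nu> = case_nat t \<nu>"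
  by (auto simp: fun_eq_iff split: nat.split)

lemma inst_sub_lift: "subst_tm (inst_sub \<sigma> t) \<circ> (lift_tm \<sigma> \<circ> \<mu>) = \<mu>"
  by (auto simp: fun_eq_iff)

lemma relat_inst_num:
  "relat \<nu> \<mu> (inst_num t \<phi>) = subst_fm (inst_sub Base (val \<nu> t)) (relat (ext Base \<nu>) (lift_tm Base \<circ> \<mu>) \<phi>)"
proof -
  have "val \<nu> \<circ> case_nat t NVar = case_nat (val \<nu> t) \<nu>"
    by (auto simp: fun_eq_iff split: nat.split)
  then show ?thesis by (simp add: inst_num_def inst_sub_ext inst_sub_lift)
qed

lemma relat_inst_set:
  "relat \<nu> \<mu> (inst_set X \<phi>) = subst_fm (inst_sub Fun (\<mu> X)) (relat (lift_tm Fun \<circ> \<nu>) (ext Fun \<mu>) \<phi>)"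
proof -
  have "\<mu> \<circ> case_nat X id = case_nat (\<mu> X) \<mu>" "val \<nu> \<circ> NVar = \<nu>"
    by (auto simp: fun_eq_iff split: nat.split)
  then show ?thesis by (simp add: inst_set_def inst_sub_ext inst_sub_lift)
qed

lemma relat_at_suc:
  "relat (ext Base \<nu>) (lift_tm Base \<circ> \<mu>) (at_suc \<phi>) = at_succ (relat (ext Base \<nu>) (lift_tm Base \<circ> \<mu>) \<phi>)"
proof -
  let ?\<theta> = "\<lambda>\<rho> n. if \<rho> = Base \<and> n = 0 then App Succ (Var Base 0) else Var \<rho> n"
  have lift: "subst_tm ?\<theta> (lift_tm Base t) = lift_tm Base t" for t
    unfolding subst_tm_subst_tm
    by (rule arg_cong[where f = "\<lambda>\<theta>. subst_tm \<theta> t"]) (auto simp: fun_eq_iff shift_def)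
  have "val (ext Base \<nu>) \<circ> case_nat (NSuc (NVar 0)) (\<lambda>n. NVar (Suc n)) = subst_tm ?\<theta> \<circ> ext Base \<nu>"
    by (auto simp: fun_eq_iff lift split: nat.split)
  moreover have "subst_tm ?\<theta> \<circ> (lift_tm Base \<circ> \<mu>) = lift_tm Base \<circ> \<mu>"
    by (auto simp: fun_eq_iff lift)
  ultimately show ?thesis by (simp add: at_suc_def at_succ_def)
qed

text \<open>
  A variable of type 0 ranges over standard and nonstandard numbers, so the translation of
  an open derivation has to assume that its number variables denote standard numbers.  The
  assumption is made for all indices, which spares keeping track of the variables that occur.
\<close>

definition ctx :: "(nat \<Rightarrow> tm) \<Rightarrow> (nat \<Rightarrow> tm) \<Rightarrow> pfm set \<Rightarrow> fm set" where
  "ctx \<nu> \<mu> \<Gamma> = range (\<lambda>n. St Base (\<nu> n)) \<union> relat \<nu> \<mu> ` \<Gamma>"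

lemma ctx_insert: "ctx \<nu> \<mu> (insert \<phi> \<Gamma>) = insert (relat \<nu> \<mu> \<phi>) (ctx \<nu> \<mu> \<Gamma>)"
  by (simp add: ctx_def)

lemma ctx_lift_num: "ctx (ext Base \<nu>) (lift_tm Base \<circ> \<mu>) (lift_num ` \<Gamma>) = std_ctx (ctx \<nu> \<mu> \<Gamma>)"
proof -
  have "range (\<lambda>n. St Base (ext Base \<nu> n)) =
      insert (St Base (Var Base 0)) (range (\<lambda>n. St Base (lift_tm Base (\<nu> n))))"
    by (auto simp: image_iff split: nat.splits)
  then show ?thesis
    unfolding ctx_def image_Un image_image relat_lift_num by simp
qed

lemma ctx_lift_set: "ctx (lift_tm Fun \<circ> \<nu>) (ext Fun \<mu>) (lift_set ` \<Gamma>) = lift_fm Fun ` ctx \<nu> \<mu> \<Gamma>"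
  unfolding ctx_def image_Un image_image relat_lift_set by simp

section \<open>Soundness of the translation\<close>

context saturated_arithmetic
begin

lemma St_val:
  assumes "\<And>n. \<Gamma> \<turnstile> St Base (\<nu> n)"
  shows "\<Gamma> \<turnstile> St Base (val \<nu> t)"
  using assms by (induction t) (simp_all add: St_Zero St_Succ St_plus St_times)

lemma St_val_ctx: "env \<nu> \<mu> \<Longrightarrow> ctx \<nu> \<mu> \<Gamma> \<turnstile> St Base (val \<nu> t)"
  by (rule St_val) (auto intro: nd.Asm simp: ctx_def env_def)

text \<open>
  The translated induction formula contains quantifiers over standard numbers in general, so it is an
  instance of external induction; it remains to unfold the quantifier \<open>AllSt\<close>.
\<close>

lemma relat_induction:
  assumes env: "env \<nu> \<mu>"
  shows "\<Gamma> \<turnstile> relat \<nu> \<mu> (PImp (PConj (inst_num NZero \<phi>) (AllN (PImp \<phi> (at_suc \<phi>)))) (AllN \<phi>))"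
proof -
  define \<psi> where "\<psi> = relat (ext Base \<nu>) (lift_tm Base \<circ> \<mu>) \<phi>"
  have wf: "wf_fm \<psi>" using env by (simp add: \<psi>_def)
  have wf_succ: "wf_fm (at_succ \<psi>)" unfolding \<psi>_def relat_at_suc[symmetric] using env by simp
  have wf_inst: "wf_fm (inst Base Zero \<psi>)" using wf by (simp add: inst_eq)
  have "\<Gamma> \<turnstile> Imp (Conj (inst Base Zero \<psi>) (AllStd (Imp \<psi> (at_succ \<psi>)))) (AllStd \<psi>)"
  proof (rule nd_ImpI)
    fix \<Delta> assume prem: "\<Delta> \<turnstile> Conj (inst Base Zero \<psi>) (AllStd (Imp \<psi> (at_succ \<psi>)))"
    then have "\<Delta> \<turnstile> AllSt Base (Imp \<psi> (at_succ \<psi>))"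
      unfolding nd_Conj using wf wf_succ by (intro nd_IffD2[OF AllSt_iff]) auto
    with prem have "\<Delta> \<turnstile> Conj (inst Base Zero \<psi>) (AllSt Base (Imp \<psi> (at_succ \<psi>)))"
      unfolding nd_Conj by blast
    moreover have "\<Delta> \<turnstile> Imp (Conj (inst Base Zero \<psi>) (AllSt Base (Imp \<psi> (at_succ \<psi>)))) (AllSt Base \<psi>)"
      using wf wf_succ wf_inst by (intro ST_ax ST.external_induction) auto
    ultimately have "\<Delta> \<turnstile> AllSt Base \<psi>" by (metis nd.ImpE)
    then show "\<Delta> \<turnstile> AllStd \<psi>" by (rule nd_IffD1[OF AllSt_iff[OF wf]])
  qed (use wf wf_succ wf_inst in auto)
  then show ?thesis
    by (simp add: relat_inst_num relat_at_suc \<psi>_def inst_eq del: subst_relat relat_subst)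
qed

text \<open>
  The values of a characteristic function with zeros as elements: 0 if \<open>\<psi>\<close> holds and 1 otherwise.
\<close>

lemma characteristic_value:
  assumes "wf_fm \<psi>"
  shows "\<Gamma> \<turnstile> Ex Base (Iff (Eq (Var Base 0) Zero) (lift_fm Base \<psi>))"
  using excluded_middle[OF assms]
proof (rule nd.DisjE)
  have "insert \<psi> \<Gamma> \<turnstile> Iff (Eq Zero Zero) \<psi>"
    using assms by (intro nd_IffI) (auto intro: nd.Asm Eq_refl)
  then show "insert \<psi> \<Gamma> \<turnstile> Ex Base (Iff (Eq (Var Base 0) Zero) (lift_fm Base \<psi>))"
    by (intro nd_ExI[where t = Zero]) auto
next
  let ?one = "App Succ Zero"
  have "insert (Neg \<psi>) \<Gamma> \<turnstile> Iff (Eq ?one Zero) \<psi>"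
  proof (rule nd_IffI)
    fix \<Delta> assume "\<Delta> \<turnstile> Eq ?one Zero"
    moreover have "\<Delta> \<turnstile> Neg (Eq ?one Zero)" by (intro EHA_ax EHA.succ_not_zero) auto
    ultimately have "\<Delta> \<turnstile> Fls" by (metis nd.ImpE)
    then show "\<Delta> \<turnstile> \<psi>" using assms by (rule nd.FlsE)
  next
    fix \<Delta> assume "insert (Neg \<psi>) \<Gamma> \<subseteq> \<Delta>" "\<Delta> \<turnstile> \<psi>"
    moreover from this have "\<Delta> \<turnstile> Neg \<psi>" using assms by (intro nd.Asm) auto
    ultimately have "\<Delta> \<turnstile> Fls" by (metis nd.ImpE)
    then show "\<Delta> \<turnstile> Eq ?one Zero" by (rule nd.FlsE) auto
  qed (use assms in auto)
  then show "insert (Neg \<psi>) \<Gamma> \<turnstile> Ex Base (Iff (Eq (Var Base 0) Zero) (lift_fm Base \<psi>))"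
    by (intro nd_ExI[where t = ?one]) auto
qed

text \<open>
  Saturation collects the values of the characteristic function of \<open>\<phi>\<close> on the standard numbers into
  one function, which may be nonstandard; this is why all functions are admitted as sets.
\<close>

lemma relat_comprehension:
  assumes env: "env \<nu> \<mu>"
  shows "\<Gamma> \<turnstile> relat \<nu> \<mu> (ExS (AllN (PIff (PMem (NVar 0) 0) (lift_set \<phi>))))"
proof -
  define \<psi> where "\<psi> = relat (ext Base \<nu>) (lift_tm Base \<circ> \<mu>) \<phi>"
  define \<Phi> where "\<Phi> = Iff (Eq (Var Base 0) Zero) (lift_fm Base \<psi>)"
  define \<chi> where "\<chi> = inst Base (App (Var Fun 0) (Var Base 0)) (lift_fm Fun \<Phi>)"
  have wf: "wf_fm \<psi>" "wf_fm \<Phi>" "wf_fm \<chi>"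
    using env by (auto simp: \<psi>_def \<Phi>_def \<chi>_def inst_eq simp del: subst_relat)
  have "\<Gamma> \<turnstile> AllStd (Ex Base \<Phi>)"
    unfolding \<Phi>_def by (rule AllStdI, rule characteristic_value[OF wf(1)])
  then have "\<Gamma> \<turnstile> AllSt Base (Ex Base \<Phi>)"
    using wf by (intro nd_IffD2[OF AllSt_iff]) auto
  moreover have "\<Gamma> \<turnstile> Imp (AllSt Base (Ex Base \<Phi>)) (Ex Fun (AllSt Base \<chi>))"
    using CSAT0 wf by (intro nd.Ax) (auto simp: CSAT0_def \<chi>_def)
  ultimately have "\<Gamma> \<turnstile> Ex Fun (AllSt Base \<chi>)" by (metis nd.ImpE)
  then have "\<Gamma> \<turnstile> Ex Fun (AllStd \<chi>)"
    by (rule nd_Ex_mono) (rule nd_IffD1[OF AllSt_iff], use wf in \<open>auto intro: nd.Asm\<close>)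
  moreover have "relat \<nu> \<mu> (ExS (AllN (PIff (PMem (NVar 0) 0) (lift_set \<phi>)))) = Ex Fun (AllStd \<chi>)"
  proof -
    let ?i = "inst_sub Base (App (Var Fun 0) (Var Base 0))"
    \<comment> \<open>In the premise of saturation the parameters are lifted past \<open>n\<close> and \<open>x\<close>; in its conclusion \<open>x\<close> has been
      replaced by \<open>f n\<close>, which undoes one lifting, and \<open>f\<close> is bound outside \<open>n\<close>.\<close>
    have swap: "subst_tm ?i (lift_tm Fun (lift_tm Base (lift_tm Base t))) = lift_tm Base (lift_tm Fun t)" for t
      unfolding subst_tm_subst_tm
      by (rule arg_cong[where f = "\<lambda>\<theta>. subst_tm \<theta> t"])
        (auto simp: fun_eq_iff shift_def inst_sub_def)
    have "subst_tm ?i \<circ> (lift_tm Fun \<circ> (lift_tm Base \<circ> ext Base \<nu>)) = ext Base (lift_tm Fun \<circ> \<nu>)"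
      by (auto simp: fun_eq_iff swap split: nat.split)
    moreover have "subst_tm ?i \<circ> (lift_tm Fun \<circ> (lift_tm Base \<circ> (lift_tm Base \<circ> \<mu>)))
        = lift_tm Base \<circ> (lift_tm Fun \<circ> \<mu>)"
      by (auto simp: fun_eq_iff swap)
    moreover have "val (ext Base (lift_tm Fun \<circ> \<nu>)) \<circ> NVar = ext Base (lift_tm Fun \<circ> \<nu>)"
      "(lift_tm Base \<circ> ext Fun \<mu>) \<circ> Suc = lift_tm Base \<circ> (lift_tm Fun \<circ> \<mu>)"
      by auto
    ultimately show ?thesis by (simp add: \<chi>_def \<Phi>_def \<psi>_def inst_eq)
  qed
  ultimately show ?thesis by simp
qed

text \<open>
  Apart from induction and comprehension, the axioms of arithmetic turn into quantifier-free facts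
  about terms of type 0 that hold for nonstandard numbers as well.
\<close>

lemma relat_axiom:
  assumes "\<phi> \<in> PA2" and env: "env \<nu> \<mu>"
  shows "\<Gamma> \<turnstile> relat \<nu> \<mu> \<phi>"
  using assms(1)
proof cases
  case p_induction
  then show ?thesis using relat_induction[OF env] by simp
next
  case p_comprehension
  then show ?thesis using relat_comprehension[OF env] by simp
next
  case (p_cong_mem s t X)
  have X: "has_ty (\<mu> X) Fun" using env by (simp add: env_def)
  have "\<Gamma> \<turnstile> Imp (Conj (Eq (val \<nu> s) (val \<nu> t)) (Eq (App (\<mu> X) (val \<nu> s)) Zero))
      (Eq (App (\<mu> X) (val \<nu> t)) Zero)"
    using X ty_val[OF env]
    by (intro nd_ImpI) (auto simp: nd_Conj intro: Eq_trans[OF Eq_sym[OF App_cong]])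
  with p_cong_mem show ?thesis by simp
next
  case (p_trans r s t)
  then show ?thesis using ty_val[OF env] by (auto simp: nd_Conj intro!: nd_ImpI elim: Eq_trans)
next
  case (p_suc_not_zero t)
  then show ?thesis using ty_val[OF env] by (auto intro!: EHA_ax EHA.succ_not_zero)
next
  case (p_suc_inj s t)
  then show ?thesis using ty_val[OF env] by (auto intro!: EHA_ax EHA.succ_inj)
qed (use ty_val[OF env] in \<open>auto simp: nd_Conj intro!: nd_ImpI intro: Eq_refl Eq_sym App_cong plus_cong times_cong
    plus_Zero plus_Succ times_Zero times_Succ\<close>)

text \<open>
  The environments are arbitrary because the quantifier rules extend them.  Standardness of the
  parameters is used in the rules that instantiate a number quantifier with a term: there the value
  of the term must be standard.
\<close>

theorem relat_sound:
  "pnd PA2 \<Gamma> \<phi> \<Longrightarrow> env \<nu> \<mu> \<Longrightarrow> ctx \<nu> \<mu> \<Gamma> \<turnstile> relat \<nu> \<mu> \<phi>"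
proof (induction arbitrary: \<nu> \<mu> rule: pnd.induct)
  case (PAx \<phi> \<Gamma>)
  then show ?case by (blast intro: relat_axiom)
next
  case (PAsm \<phi> \<Gamma>)
  then show ?case by (auto intro!: nd.Asm simp: ctx_def)
next
  case (PClassical \<phi> \<Gamma>)
  from PClassical.IH[OF PClassical.prems] PClassical.prems show ?case
    by (auto intro: classical simp: ctx_insert)
next
  case (PConjI \<Gamma> \<phi> \<psi>)
  then show ?case by (simp add: nd_Conj)
next
  case (PConjE1 \<Gamma> \<phi> \<psi>)
  then show ?case by (simp add: nd_Conj)
next
  case (PConjE2 \<Gamma> \<phi> \<psi>)
  then show ?case by (simp add: nd_Conj)
next
  case (PDisjI1 \<Gamma> \<phi> \<psi>)
  then show ?case by (simp add: nd.DisjI1)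
next
  case (PDisjI2 \<Gamma> \<psi> \<phi>)
  then show ?case by (simp add: nd.DisjI2)
next
  case (PDisjE \<Gamma> \<phi> \<psi> \<chi>)
  from PDisjE.IH(1)[OF PDisjE.prems, simplified] PDisjE.IH(2,3)[OF PDisjE.prems]
  show ?case unfolding ctx_insert by (rule nd.DisjE)
next
  case (PImpI \<phi> \<Gamma> \<psi>)
  from PImpI.IH[OF PImpI.prems] PImpI.prems show ?case
    by (simp add: ctx_insert nd.ImpI)
next
  case (PImpE \<Gamma> \<phi> \<psi>)
  from PImpE.IH(1)[OF PImpE.prems, simplified] PImpE.IH(2)[OF PImpE.prems]
  show ?case by (rule nd.ImpE)
next
  case (AllNI \<Gamma> \<phi>)
  have "ctx (ext Base \<nu>) (lift_tm Base \<circ> \<mu>) (lift_num ` \<Gamma>) \<turnstile> relat (ext Base \<nu>) (lift_tm Base \<circ> \<mu>) \<phi>"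
    by (rule AllNI.IH, rule env_ext, rule AllNI.prems)
  then show ?case by (simp only: ctx_lift_num relat.simps AllStdI)
next
  case (AllNE \<Gamma> \<phi> t)
  from AllNE.IH[OF AllNE.prems, simplified] have
    "ctx \<nu> \<mu> \<Gamma> \<turnstile> subst_fm (inst_sub Base (val \<nu> t)) (relat (ext Base \<nu>) (lift_tm Base \<circ> \<mu>) \<phi>)"
    by (rule AllStdE) (use AllNE.prems in \<open>simp_all add: St_val_ctx\<close>)
  then show ?case by (simp only: relat_inst_num)
next
  case (ExNI \<Gamma> t \<phi>)
  from ExNI.IH[OF ExNI.prems] show ?case
    unfolding relat.simps relat_inst_num
    by (rule ExStdI) (use ExNI.prems in \<open>simp_all add: St_val_ctx\<close>)
next
  case (ExNE \<Gamma> \<phi> \<psi>)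
  have "ctx (ext Base \<nu>) (lift_tm Base \<circ> \<mu>) (insert \<phi> (lift_num ` \<Gamma>))
      \<turnstile> relat (ext Base \<nu>) (lift_tm Base \<circ> \<mu>) (lift_num \<psi>)"
    by (rule ExNE.IH(2), rule env_ext, rule ExNE.prems)
  with ExNE.IH(1)[OF ExNE.prems] show ?case
    unfolding ctx_insert ctx_lift_num relat_lift_num relat.simps by (rule ExStdE)
next
  case (AllSI \<Gamma> \<phi>)
  have "ctx (lift_tm Fun \<circ> \<nu>) (ext Fun \<mu>) (lift_set ` \<Gamma>) \<turnstile> relat (lift_tm Fun \<circ> \<nu>) (ext Fun \<mu>) \<phi>"
    by (rule AllSI.IH, rule env_ext, rule AllSI.prems)
  then show ?case by (simp only: ctx_lift_set relat.simps nd.AllI)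
next
  case (AllSE \<Gamma> \<phi> X)
  from AllSE.prems have "has_ty (\<mu> X) Fun" by (simp add: env_def)
  with AllSE.IH[OF AllSE.prems] show ?case
    unfolding relat.simps relat_inst_set by (rule nd_AllE)
next
  case (ExSI \<Gamma> X \<phi>)
  from ExSI.prems have X: "has_ty (\<mu> X) Fun" by (simp add: env_def)
  from ExSI.IH[OF ExSI.prems] show ?case
    unfolding relat.simps relat_inst_set using X by (rule nd_ExI)
next
  case (ExSE \<Gamma> \<phi> \<psi>)
  have "ctx (lift_tm Fun \<circ> \<nu>) (ext Fun \<mu>) (insert \<phi> (lift_set ` \<Gamma>))
      \<turnstile> relat (lift_tm Fun \<circ> \<nu>) (ext Fun \<mu>) (lift_set \<psi>)"
    by (rule ExSE.IH(2), rule env_ext, rule ExSE.prems)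
  with ExSE.IH(1)[OF ExSE.prems] show ?case
    unfolding ctx_insert ctx_lift_set relat_lift_set relat.simps by (rule nd.ExE)
qed

end

section \<open>The relative interpretation\<close>

text \<open>
  A set is coded by the zeros of a function.  Different functions code the same set, which does no
  harm: equality of sets is coextensiveness and not a symbol that would have to be interpreted.
\<close>

definition std_interp :: interp where
  "std_interp = \<lparr>
     num_ty = Base,
     set_ty = Fun,
     num_dom = St Base (Var Base 0),
     set_dom = Imp Fls Fls,
     i_eq = Eq (Var Base 0) (Var Base 1),
     i_mem = Eq (App (Var Fun 1) (Var Base 0)) Zero,
     i_zero = Eq Zero (Var Base 0),
     i_suc = Eq (App Succ (Var Base 0)) (Var Base 1),
     i_plus = Eq (plus (Var Base 0) (Var Base 1)) (Var Base 2),
     i_times = Eq (times (Var Base 0) (Var Base 1)) (Var Base 2)\<rparr>"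

lemma std_interp_simps [simp]:
  "num_ty std_interp = Base"
  "set_ty std_interp = Fun"
  "app_fm (i_eq std_interp) [s, t] = Eq s t"
  "app_fm (i_mem std_interp) [t, f] = Eq (App f t) Zero"
  "app_fm (i_zero std_interp) [t] = Eq Zero t"
  "app_fm (i_suc std_interp) [s, t] = Eq (App Succ s) t"
  "app_fm (i_plus std_interp) [r, s, t] = Eq (plus r s) t"
  "app_fm (i_times std_interp) [r, s, t] = Eq (times r s) t"
  "all_num std_interp \<phi> = AllStd \<phi>"
  "ex_num std_interp \<phi> = ExStd \<phi>"
  "all_set std_interp \<phi> = All Fun (Imp (Imp Fls Fls) \<phi>)"
  "ex_set std_interp \<phi> = Ex Fun (Conj (Imp Fls Fls) \<phi>)"
  by (simp_all add: std_interp_def app_fm_def all_num_def ex_num_def all_set_def ex_set_def)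

lemma wf_std_interp: "wf_interp std_interp"
  by (auto simp: wf_interp_def has_args_def std_interp_def numeral_2_eq_2 all_conj_distrib
      less_Suc_eq_0_disj intro!: exI)

lemma tr_val_cong: "(\<And>n. n \<in> fv_ntm t \<Longrightarrow> \<nu> n = \<nu>' n) \<Longrightarrow> tr_val I \<nu> t y = tr_val I \<nu>' t y"
proof (induction t arbitrary: \<nu> \<nu>' y)
  case (NSuc t)
  have "tr_val I (\<theta> \<circ> \<nu>) t y = tr_val I (\<theta> \<circ> \<nu>') t y" for \<theta> y
    by (rule NSuc.IH) (simp add: NSuc.prems)
  then show ?case by (simp add: Let_def)
next
  case (NPlus s t)
  have "tr_val I (\<theta> \<circ> \<nu>) s y = tr_val I (\<theta> \<circ> \<nu>') s y" for \<theta> y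
    by (rule NPlus.IH) (simp add: NPlus.prems)
  moreover have "tr_val I (\<theta> \<circ> \<nu>) t y = tr_val I (\<theta> \<circ> \<nu>') t y" for \<theta> y
    by (rule NPlus.IH) (simp add: NPlus.prems)
  ultimately show ?case by (simp add: Let_def)
next
  case (NTimes s t)
  have "tr_val I (\<theta> \<circ> \<nu>) s y = tr_val I (\<theta> \<circ> \<nu>') s y" for \<theta> y
    by (rule NTimes.IH) (simp add: NTimes.prems)
  moreover have "tr_val I (\<theta> \<circ> \<nu>) t y = tr_val I (\<theta> \<circ> \<nu>') t y" for \<theta> y
    by (rule NTimes.IH) (simp add: NTimes.prems)
  ultimately show ?case by (simp add: Let_def)
qed auto

text \<open>
  For a sentence this permits an environment whose values are provably standard, in place of free
  variables.
\<close>

lemma tr_cong: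
  "(\<And>n. n \<in> fv_num \<phi> \<Longrightarrow> \<nu> n = \<nu>' n) \<Longrightarrow> tr I \<nu> \<mu> \<phi> = tr I \<nu>' \<mu> \<phi>"
proof (induction \<phi> arbitrary: \<nu> \<nu>' \<mu>)
  case (PEq s t)
  have "tr_val I (\<theta> \<circ> \<nu>) s y = tr_val I (\<theta> \<circ> \<nu>') s y"
    "tr_val I (\<theta> \<circ> \<nu>) t y = tr_val I (\<theta> \<circ> \<nu>') t y" for \<theta> y
    by (rule tr_val_cong, simp add: PEq)+
  then show ?case by (simp add: Let_def)
next
  case (PMem t X)
  have "tr_val I (\<theta> \<circ> \<nu>) t y = tr_val I (\<theta> \<circ> \<nu>') t y" for \<theta> y
    by (rule tr_val_cong) (simp add: PMem)
  then show ?case by (simp add: Let_def)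
next
  case (PConj \<phi> \<psi>)
  show ?case using PConj.IH(1)[of \<nu> \<nu>' \<mu>] PConj.IH(2)[of \<nu> \<nu>' \<mu>] PConj.prems by simp
next
  case (PDisj \<phi> \<psi>)
  show ?case using PDisj.IH(1)[of \<nu> \<nu>' \<mu>] PDisj.IH(2)[of \<nu> \<nu>' \<mu>] PDisj.prems by simp
next
  case (PImp \<phi> \<psi>)
  show ?case using PImp.IH(1)[of \<nu> \<nu>' \<mu>] PImp.IH(2)[of \<nu> \<nu>' \<mu>] PImp.prems by simp
next
  case (AllN \<phi>)
  have "tr I (case_nat x (\<theta> \<circ> \<nu>)) \<mu> \<phi> = tr I (case_nat x (\<theta> \<circ> \<nu>')) \<mu> \<phi>" for x \<theta> \<mu>
    by (rule AllN.IH) (use AllN.prems in \<open>auto split: nat.split\<close>)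
  then show ?case by (simp add: Let_def)
next
  case (ExN \<phi>)
  have "tr I (case_nat x (\<theta> \<circ> \<nu>)) \<mu> \<phi> = tr I (case_nat x (\<theta> \<circ> \<nu>')) \<mu> \<phi>" for x \<theta> \<mu>
    by (rule ExN.IH) (use ExN.prems in \<open>auto split: nat.split\<close>)
  then show ?case by (simp add: Let_def)
next
  case (AllS \<phi>)
  have "tr I (\<theta> \<circ> \<nu>) \<mu> \<phi> = tr I (\<theta> \<circ> \<nu>') \<mu> \<phi>" for \<theta> \<mu>
    by (rule AllS.IH) (simp add: AllS.prems)
  then show ?case by (simp add: Let_def)
next
  case (ExS \<phi>)
  have "tr I (\<theta> \<circ> \<nu>) \<mu> \<phi> = tr I (\<theta> \<circ> \<nu>') \<mu> \<phi>" for \<theta> \<mu>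
    by (rule ExS.IH) (simp add: ExS.prems)
  then show ?case by (simp add: Let_def)
qed auto

text \<open>
  Standardness is required to be an assumption of the context and not merely provable from it, since
  assumptions are lifted together with the context, while derivations would have to be translated
  along the lifting.
\<close>

definition standard :: "fm set \<Rightarrow> (nat \<Rightarrow> tm) \<Rightarrow> bool" where
  "standard \<Gamma> \<nu> \<longleftrightarrow> (\<forall>n. has_ty (\<nu> n) Base \<and> St Base (\<nu> n) \<in> \<Gamma>)"

lemma standard_lift: "standard \<Gamma> \<nu> \<Longrightarrow> standard (std_ctx \<Gamma>) (lift_tm Base \<circ> \<nu>)"
  by (force simp: standard_def)

lemma standard_lift_Fun: "standard \<Gamma> \<nu> \<Longrightarrow> standard (lift_fm Fun ` \<Gamma>) (lift_tm Fun \<circ> \<nu>)"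
  by (force simp: standard_def)

lemma standard_ext: "standard \<Gamma> \<nu> \<Longrightarrow> standard (std_ctx \<Gamma>) (ext Base \<nu>)"
  by (force simp: standard_def split: nat.split)

lemma ty_val_standard [simp]:
  assumes "standard \<Gamma> \<nu>"
  shows "well_typed (val \<nu> t)" "ty_of (val \<nu> t) = Base"
  using assms ty_val[of \<nu> "Var Fun" t] by (auto simp: standard_def env_def)

context saturated_arithmetic
begin

lemma St_val_standard: "standard \<Gamma> \<nu> \<Longrightarrow> \<Gamma> \<turnstile> St Base (val \<nu> t)"
  by (rule St_val) (auto intro: nd.Asm simp: standard_def)

text \<open>
  The rule that \<open>\<exists>v. t = v \<and> \<psi>\<close> is equivalent to \<open>\<psi>\<close>, for standard \<open>t\<close> and for a body \<open>\<phi>\<close> that implies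
  the equation and is equivalent to \<open>\<psi>\<close> under it.  The instance of \<open>\<phi>\<close> at \<open>t\<close> is never computed: for
  the direction from right to left, the equivalence is generalized over \<open>v\<close> and then instantiated
  with \<open>t\<close>, so that no principle of substituting equals in \<open>\<phi>\<close> is involved.
\<close>

lemma one_point:
  assumes t: "has_ty t Base" and st: "\<Gamma> \<turnstile> St Base t" and wf: "wf_fm \<phi>" "wf_fm \<psi>"
    and eq: "\<And>\<Delta>. std_ctx \<Gamma> \<subseteq> \<Delta> \<Longrightarrow> \<Delta> \<turnstile> \<phi> \<Longrightarrow> \<Delta> \<turnstile> Eq (lift_tm Base t) (Var Base 0)"
    and iff: "\<And>\<Delta>. std_ctx \<Gamma> \<subseteq> \<Delta> \<Longrightarrow> \<Delta> \<turnstile> Eq (lift_tm Base t) (Var Base 0) \<Longrightarrow>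
      (\<Delta> \<turnstile> \<phi>) = (\<Delta> \<turnstile> lift_fm Base \<psi>)"
  shows "\<Gamma> \<turnstile> Iff (ExStd \<phi>) \<psi>"
proof (rule nd_IffI)
  let ?e = "Eq (lift_tm Base t) (Var Base 0)"
  show "wf_fm (ExStd \<phi>)" using wf by simp
  fix \<Delta> assume \<Delta>: "\<Gamma> \<subseteq> \<Delta>"
  {
    assume "\<Delta> \<turnstile> ExStd \<phi>"
    then show "\<Delta> \<turnstile> \<psi>"
    proof (rule ExStdE)
      let ?\<Delta> = "insert \<phi> (std_ctx \<Delta>)"
      have "?\<Delta> \<turnstile> \<phi>" using wf by (intro nd.Asm) auto
      moreover have "std_ctx \<Gamma> \<subseteq> ?\<Delta>" using \<Delta> by auto
      ultimately show "?\<Delta> \<turnstile> lift_fm Base \<psi>" using eq iff by blast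
    qed
  }
  assume \<psi>: "\<Delta> \<turnstile> \<psi>"
  have "\<Gamma> \<turnstile> AllStd (Imp ?e (Iff \<phi> (lift_fm Base \<psi>)))"
  proof (rule AllStdI, rule nd_ImpI, goal_cases)
    case (2 \<Delta>)
    have "std_ctx \<Gamma> \<subseteq> \<Delta>' \<Longrightarrow> \<Delta> \<subseteq> \<Delta>' \<Longrightarrow> (\<Delta>' \<turnstile> \<phi>) = (\<Delta>' \<turnstile> lift_fm Base \<psi>)" for \<Delta>'
      by (rule iff, assumption, rule nd_mono[OF 2(2)])
    with 2(1) show ?case using wf by (intro nd_IffI) auto
  qed (use t in simp)
  from AllStdE[OF this t st]
  have "\<Gamma> \<turnstile> Imp (Eq t t) (Iff (subst_fm (inst_sub Base t) \<phi>) \<psi>)" by simp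
  from nd.ImpE[OF this Eq_refl[OF t]] have "\<Delta> \<turnstile> Iff (subst_fm (inst_sub Base t) \<phi>) \<psi>"
    using \<Delta> by (rule nd_mono)
  from nd_IffD2[OF this \<psi>] t nd_mono[OF st \<Delta>] show "\<Delta> \<turnstile> ExStd \<phi>" by (rule ExStdI)
qed (rule wf)

lemma one_point_unary:
  assumes t: "has_ty t Base" and st: "\<Gamma> \<turnstile> St Base t"
    and f: "has_ty f Fun" and y: "has_ty y Base"
    and \<tau>: "std_ctx \<Gamma> \<turnstile> Iff \<tau> (Eq (lift_tm Base t) (Var Base 0))"
  shows "\<Gamma> \<turnstile> Iff (ExStd (Conj \<tau> (Eq (App (lift_tm Base f) (Var Base 0)) (lift_tm Base y)))) (Eq (App f t) y)"
proof (rule one_point[OF t st])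
  fix \<Delta> assume \<Delta>: "std_ctx \<Gamma> \<subseteq> \<Delta>"
  note \<tau>_iff = Iff_mono[OF \<tau> \<Delta>]
  then show "\<Delta> \<turnstile> Conj \<tau> (Eq (App (lift_tm Base f) (Var Base 0)) (lift_tm Base y)) \<Longrightarrow>
    \<Delta> \<turnstile> Eq (lift_tm Base t) (Var Base 0)" by (simp add: nd_Conj)
  assume e: "\<Delta> \<turnstile> Eq (lift_tm Base t) (Var Base 0)"
  then have f_eq: "\<Delta> \<turnstile> Eq (App (lift_tm Base f) (lift_tm Base t)) (App (lift_tm Base f) (Var Base 0))"
    using f by (simp add: App_cong)
  show "(\<Delta> \<turnstile> Conj \<tau> (Eq (App (lift_tm Base f) (Var Base 0)) (lift_tm Base y))) =
    (\<Delta> \<turnstile> lift_fm Base (Eq (App f t) y))"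
    using Eq_trans[OF f_eq] Eq_trans[OF Eq_sym[OF f_eq]] e \<tau>_iff by (auto simp: nd_Conj)
qed (use t f y nd_wf[OF \<tau>] in auto)

text \<open>
  Both arguments of a binary relation are eliminated, the inner one first.  The parameter \<open>y\<close> of \<open>R\<close> is
  the prescribed value if \<open>R\<close> is the graph of a function.
\<close>

lemma one_point_binary:
  assumes s: "has_ty s Base" and st_s: "\<Gamma> \<turnstile> St Base s"
    and t: "has_ty t Base" and st_t: "std_ctx \<Gamma> \<turnstile> St Base (lift_tm Base t)"
    and y: "has_ty y Base"
    and \<sigma>: "std_ctx (std_ctx \<Gamma>) \<turnstile> Iff \<sigma> (Eq (lift_tm Base (lift_tm Base s)) (Var Base 1))"
    and \<tau>: "std_ctx (std_ctx \<Gamma>) \<turnstile> Iff \<tau> (Eq (lift_tm Base (lift_tm Base t)) (Var Base 0))"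
    and wf: "\<And>s t y. has_ty s Base \<Longrightarrow> has_ty t Base \<Longrightarrow> has_ty y Base \<Longrightarrow> wf_fm (R s t y)"
    and lift: "\<And>s t y. lift_fm Base (R s t y) = R (lift_tm Base s) (lift_tm Base t) (lift_tm Base y)"
    and cong: "\<And>\<Delta> s s' t t' y. \<Delta> \<turnstile> Eq s s' \<Longrightarrow> \<Delta> \<turnstile> Eq t t' \<Longrightarrow> \<Delta> \<turnstile> R s t y \<Longrightarrow> \<Delta> \<turnstile> R s' t' y"
  shows "\<Gamma> \<turnstile> Iff (ExStd (ExStd (Conj (Conj \<sigma> \<tau>) (R (Var Base 1) (Var Base 0) (lift_tm Base (lift_tm Base y))))))
    (R s t y)"
proof (rule one_point[OF s st_s])
  let ?v = "Var Base 0" and ?w = "Var Base 1" and ?L = "lift_tm Base"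
  let ?y = "?L (?L y)"
  let ?B = "Conj (Conj \<sigma> \<tau>) (R ?w ?v ?y)"
  \<comment> \<open>With the inner variable eliminated, the equation for \<open>s\<close> is left as the one that determines the outer variable.\<close>
  have "std_ctx \<Gamma> \<turnstile> Iff (ExStd ?B) (Conj (Eq (?L s) ?v) (R ?v (?L t) (?L y)))"
  proof (rule one_point[OF _ st_t])
    fix \<Delta> assume \<Delta>: "std_ctx (std_ctx \<Gamma>) \<subseteq> \<Delta>"
    note iffs = Iff_mono[OF \<sigma> \<Delta>] Iff_mono[OF \<tau> \<Delta>]
    then show "\<Delta> \<turnstile> ?B \<Longrightarrow> \<Delta> \<turnstile> Eq (?L (?L t)) ?v" by (simp add: nd_Conj)
    assume e: "\<Delta> \<turnstile> Eq (?L (?L t)) ?v"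
    have w: "\<Delta> \<turnstile> Eq ?w ?w" by (rule Eq_refl) simp
    have "(\<Delta> \<turnstile> R ?w ?v ?y) = (\<Delta> \<turnstile> R ?w (?L (?L t)) ?y)"
      using cong[OF w e] cong[OF w Eq_sym[OF e]] by blast
    then show "(\<Delta> \<turnstile> ?B) = (\<Delta> \<turnstile> lift_fm Base (Conj (Eq (?L s) ?v) (R ?v (?L t) (?L y))))"
      using e iffs by (simp add: nd_Conj lift)
  qed (use t s y wf nd_wf[OF \<sigma>] nd_wf[OF \<tau>] in auto)
  note B_iff = Iff_mono[OF this]
  fix \<Delta> assume \<Delta>: "std_ctx \<Gamma> \<subseteq> \<Delta>"
  from B_iff[OF \<Delta>] show "\<Delta> \<turnstile> ExStd ?B \<Longrightarrow> \<Delta> \<turnstile> Eq (?L s) ?v" by (simp add: nd_Conj)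
  assume e: "\<Delta> \<turnstile> Eq (?L s) ?v"
  have t': "\<Delta> \<turnstile> Eq (?L t) (?L t)" using t by (intro Eq_refl) simp
  have "(\<Delta> \<turnstile> R ?v (?L t) (?L y)) = (\<Delta> \<turnstile> R (?L s) (?L t) (?L y))"
    using cong[OF e t'] cong[OF Eq_sym[OF e] t'] by blast
  then show "(\<Delta> \<turnstile> ExStd ?B) = (\<Delta> \<turnstile> lift_fm Base (R s t y))"
    using e B_iff[OF \<Delta>] by (simp add: nd_Conj lift)
qed (use s t y wf nd_wf[OF \<sigma>] nd_wf[OF \<tau>] in auto)

lemma tr_val_binary:
  assumes std: "standard \<Gamma> \<nu>" and y: "has_ty y Base"
    and s: "\<And>\<Gamma> \<nu> y. standard \<Gamma> \<nu> \<Longrightarrow> has_ty y Base \<Longrightarrow>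
      \<Gamma> \<turnstile> Iff (tr_val std_interp \<nu> s y) (Eq (val \<nu> s) y)"
    and t: "\<And>\<Gamma> \<nu> y. standard \<Gamma> \<nu> \<Longrightarrow> has_ty y Base \<Longrightarrow>
      \<Gamma> \<turnstile> Iff (tr_val std_interp \<nu> t y) (Eq (val \<nu> t) y)"
    and wf: "\<And>s t y. has_ty s Base \<Longrightarrow> has_ty t Base \<Longrightarrow> has_ty y Base \<Longrightarrow> wf_fm (R s t y)"
    and lift: "\<And>s t y. lift_fm Base (R s t y) = R (lift_tm Base s) (lift_tm Base t) (lift_tm Base y)"
    and cong: "\<And>\<Delta> s s' t t' y. \<Delta> \<turnstile> Eq s s' \<Longrightarrow> \<Delta> \<turnstile> Eq t t' \<Longrightarrow> \<Delta> \<turnstile> R s t y \<Longrightarrow> \<Delta> \<turnstile> R s' t' y"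
  shows "\<Gamma> \<turnstile> Iff (ExStd (ExStd (Conj (Conj
        (tr_val std_interp ((lift_tm Base \<circ> lift_tm Base) \<circ> \<nu>) s (Var Base 1))
        (tr_val std_interp ((lift_tm Base \<circ> lift_tm Base) \<circ> \<nu>) t (Var Base 0)))
        (R (Var Base 1) (Var Base 0) (lift_tm Base (lift_tm Base y))))))
    (R (val \<nu> s) (val \<nu> t) y)"
proof (rule one_point_binary)
  note std1 = standard_lift[OF std]
  note std2 = standard_lift[OF std1, folded comp_assoc]
  have lift2: "lift_tm Base (lift_tm Base (val \<nu> u)) = val ((lift_tm Base \<circ> lift_tm Base) \<circ> \<nu>) u" for u
    by (simp add: comp_assoc)
  show "has_ty (val \<nu> s) Base" "has_ty (val \<nu> t) Base" using std by simp_all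
  show "\<Gamma> \<turnstile> St Base (val \<nu> s)" by (rule St_val_standard[OF std])
  show "std_ctx \<Gamma> \<turnstile> St Base (lift_tm Base (val \<nu> t))"
    unfolding subst_val by (rule St_val_standard[OF std1])
  show "std_ctx (std_ctx \<Gamma>) \<turnstile>
    Iff (tr_val std_interp ((lift_tm Base \<circ> lift_tm Base) \<circ> \<nu>) s (Var Base 1))
      (Eq (lift_tm Base (lift_tm Base (val \<nu> s))) (Var Base 1))"
    unfolding lift2 by (rule s[OF std2]) simp
  show "std_ctx (std_ctx \<Gamma>) \<turnstile>
    Iff (tr_val std_interp ((lift_tm Base \<circ> lift_tm Base) \<circ> \<nu>) t (Var Base 0))
      (Eq (lift_tm Base (lift_tm Base (val \<nu> t))) (Var Base 0))"
    unfolding lift2 by (rule t[OF std2]) simp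
qed (fact y wf lift cong)+

text \<open>
  By induction on the term, each value quantifier in the graph translation is determined by the term
  that the direct translation puts in its place, and this term is standard.
\<close>

lemma tr_val_iff:
  "standard \<Gamma> \<nu> \<Longrightarrow> has_ty y Base \<Longrightarrow> \<Gamma> \<turnstile> Iff (tr_val std_interp \<nu> t y) (Eq (val \<nu> t) y)"
proof (induction t arbitrary: \<Gamma> \<nu> y)
  case (NVar n)
  then show ?case by (auto intro!: Iff_refl simp: standard_def)
next
  case NZero
  then show ?case by (auto intro!: Iff_refl)
next
  case (NSuc t)
  have "\<Gamma> \<turnstile> Iff (ExStd (Conj (tr_val std_interp (lift_tm Base \<circ> \<nu>) t (Var Base 0))
      (Eq (App (lift_tm Base Succ) (Var Base 0)) (lift_tm Base y)))) (Eq (App Succ (val \<nu> t)) y)"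
  proof (rule one_point_unary)
    show "std_ctx \<Gamma> \<turnstile> Iff (tr_val std_interp (lift_tm Base \<circ> \<nu>) t (Var Base 0))
        (Eq (lift_tm Base (val \<nu> t)) (Var Base 0))"
      unfolding subst_val by (rule NSuc.IH[OF standard_lift[OF NSuc.prems(1)]]) simp
  qed (use NSuc.prems in \<open>simp_all add: St_val_standard\<close>)
  then show ?case by (simp add: Let_def)
next
  case (NPlus s t)
  have "\<Gamma> \<turnstile> Iff (ExStd (ExStd (Conj (Conj
      (tr_val std_interp ((lift_tm Base \<circ> lift_tm Base) \<circ> \<nu>) s (Var Base 1))
      (tr_val std_interp ((lift_tm Base \<circ> lift_tm Base) \<circ> \<nu>) t (Var Base 0)))
      (Eq (plus (Var Base 1) (Var Base 0)) (lift_tm Base (lift_tm Base y))))))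
    (Eq (plus (val \<nu> s) (val \<nu> t)) y)"
    by (rule tr_val_binary[where R = "\<lambda>s t y. Eq (plus s t) y", OF NPlus.prems NPlus.IH])
      (simp_all add: Eq_trans[OF Eq_sym[OF plus_cong]])
  then show ?case by (simp add: Let_def)
next
  case (NTimes s t)
  have "\<Gamma> \<turnstile> Iff (ExStd (ExStd (Conj (Conj
      (tr_val std_interp ((lift_tm Base \<circ> lift_tm Base) \<circ> \<nu>) s (Var Base 1))
      (tr_val std_interp ((lift_tm Base \<circ> lift_tm Base) \<circ> \<nu>) t (Var Base 0)))
      (Eq (times (Var Base 1) (Var Base 0)) (lift_tm Base (lift_tm Base y))))))
    (Eq (times (val \<nu> s) (val \<nu> t)) y)"
    by (rule tr_val_binary[where R = "\<lambda>s t y. Eq (times s t) y", OF NTimes.prems NTimes.IH])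
      (simp_all add: Eq_trans[OF Eq_sym[OF times_cong]])
  then show ?case by (simp add: Let_def)
qed

lemma tr_iff:
  "standard \<Gamma> \<nu> \<Longrightarrow> env \<nu> \<mu> \<Longrightarrow> \<Gamma> \<turnstile> Iff (tr std_interp \<nu> \<mu> \<phi>) (relat \<nu> \<mu> \<phi>)"
proof (induction \<phi> arbitrary: \<Gamma> \<nu> \<mu>)
  case PFls
  then show ?case by (auto intro: Iff_refl)
next
  case (PEq s t)
  have "\<Gamma> \<turnstile> Iff (ExStd (ExStd (Conj (Conj
      (tr_val std_interp ((lift_tm Base \<circ> lift_tm Base) \<circ> \<nu>) s (Var Base 1))
      (tr_val std_interp ((lift_tm Base \<circ> lift_tm Base) \<circ> \<nu>) t (Var Base 0)))
      (Eq (Var Base 1) (Var Base 0)))))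
    (Eq (val \<nu> s) (val \<nu> t))"
  proof (rule tr_val_binary[where R = "\<lambda>s t y. Eq s t" and y = Zero, OF PEq(1) _ tr_val_iff tr_val_iff])
    show "\<Delta> \<turnstile> Eq s s' \<Longrightarrow> \<Delta> \<turnstile> Eq t t' \<Longrightarrow> \<Delta> \<turnstile> Eq s t \<Longrightarrow> \<Delta> \<turnstile> Eq s' t'" for \<Delta> s s' t t'
      by (rule Eq_trans[OF Eq_sym Eq_trans])
  qed simp_all
  then show ?case by (simp add: Let_def)
next
  case (PMem t X)
  have X: "has_ty (\<mu> X) Fun" using PMem by (simp add: env_def)
  have "\<Gamma> \<turnstile> Iff (ExStd (Conj (tr_val std_interp (lift_tm Base \<circ> \<nu>) t (Var Base 0))
      (Eq (App (lift_tm Base (\<mu> X)) (Var Base 0)) (lift_tm Base Zero)))) (Eq (App (\<mu> X) (val \<nu> t)) Zero)"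
  proof (rule one_point_unary)
    show "std_ctx \<Gamma> \<turnstile> Iff (tr_val std_interp (lift_tm Base \<circ> \<nu>) t (Var Base 0))
        (Eq (lift_tm Base (val \<nu> t)) (Var Base 0))"
      unfolding subst_val by (rule tr_val_iff[OF standard_lift[OF PMem(1)]]) simp
  qed (use PMem X in \<open>simp_all add: St_val_standard\<close>)
  then show ?case by (simp add: Let_def)
next
  case (PConj \<phi> \<psi>)
  have "\<Gamma> \<turnstile> Iff (tr std_interp \<nu> \<mu> \<phi>) (relat \<nu> \<mu> \<phi>)" "\<Gamma> \<turnstile> Iff (tr std_interp \<nu> \<mu> \<psi>) (relat \<nu> \<mu> \<psi>)"
    using PConj by blast+
  then show ?case unfolding tr.simps relat.simps by (rule Conj_cong)
next
  case (PDisj \<phi> \<psi>)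
  have "\<Gamma> \<turnstile> Iff (tr std_interp \<nu> \<mu> \<phi>) (relat \<nu> \<mu> \<phi>)" "\<Gamma> \<turnstile> Iff (tr std_interp \<nu> \<mu> \<psi>) (relat \<nu> \<mu> \<psi>)"
    using PDisj by blast+
  then show ?case unfolding tr.simps relat.simps by (rule Disj_cong)
next
  case (PImp \<phi> \<psi>)
  have "\<Gamma> \<turnstile> Iff (tr std_interp \<nu> \<mu> \<phi>) (relat \<nu> \<mu> \<phi>)" "\<Gamma> \<turnstile> Iff (tr std_interp \<nu> \<mu> \<psi>) (relat \<nu> \<mu> \<psi>)"
    using PImp by blast+
  then show ?case unfolding tr.simps relat.simps by (rule Imp_cong)
next
  case (AllN \<phi>)
  show ?case
    unfolding tr.simps relat.simps std_interp_simps Let_def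
    by (intro AllStd_cong AllN.IH standard_ext env_ext AllN.prems)
next
  case (ExN \<phi>)
  show ?case
    unfolding tr.simps relat.simps std_interp_simps Let_def
    by (intro ExStd_cong ExN.IH standard_ext env_ext ExN.prems)
next
  case (AllS \<phi>)
  have "lift_fm Fun ` \<Gamma> \<turnstile> Iff (tr std_interp (lift_tm Fun \<circ> \<nu>) (ext Fun \<mu>) \<phi>)
      (relat (lift_tm Fun \<circ> \<nu>) (ext Fun \<mu>) \<phi>)"
    by (intro AllS.IH standard_lift_Fun env_ext AllS.prems)
  then show ?case
    unfolding tr.simps relat.simps std_interp_simps Let_def by (rule All_trivial_guard)
next
  case (ExS \<phi>)
  have "lift_fm Fun ` \<Gamma> \<turnstile> Iff (tr std_interp (lift_tm Fun \<circ> \<nu>) (ext Fun \<mu>) \<phi>)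
      (relat (lift_tm Fun \<circ> \<nu>) (ext Fun \<mu>) \<phi>)"
    by (intro ExS.IH standard_lift_Fun env_ext ExS.prems)
  then show ?case
    unfolding tr.simps relat.simps std_interp_simps Let_def by (rule Ex_trivial_guard)
qed

theorem interprets_PA2: "interprets A PA2"
  unfolding interprets_def
proof (intro exI conjI allI impI)
  show "wf_interp std_interp" by (rule wf_std_interp)
  fix \<phi> assume \<phi>: "sentence \<phi> \<and> pnd PA2 {} \<phi>"
  \<comment> \<open>A constant standard environment makes the assumptions of standardness provable.\<close>
  let ?\<nu> = "\<lambda>n::nat. Zero" and ?\<mu> = "Var Fun"
  have env: "env ?\<nu> ?\<mu>" by (simp add: env_def)
  have "{St Base Zero} \<turnstile> relat ?\<nu> ?\<mu> \<phi>"
    using relat_sound[OF conjunct2[OF \<phi>] env] by (simp add: ctx_def)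
  moreover have "{St Base Zero} \<turnstile> Iff (tr std_interp ?\<nu> ?\<mu> \<phi>) (relat ?\<nu> ?\<mu> \<phi>)"
    by (rule tr_iff[OF _ env]) (simp add: standard_def)
  ultimately have "{St Base Zero} \<turnstile> tr std_interp ?\<nu> ?\<mu> \<phi>" by (rule nd_IffD2[rotated])
  then have "{} \<turnstile> tr std_interp ?\<nu> ?\<mu> \<phi>" by (rule nd_cut[OF St_Zero])
  moreover have "tr_sentence std_interp \<phi> = tr std_interp ?\<nu> ?\<mu> \<phi>"
    using \<phi> unfolding tr_sentence_def std_interp_simps sentence_def by (intro tr_cong) auto
  ultimately show "{} \<turnstile> tr_sentence std_interp \<phi>" by simp
qed

end

theorem theorem4p1:
  shows "interprets (EPA_st \<union> OS0 \<union> CSAT0) PA2"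
proof -
  interpret saturated_arithmetic "EPA_st \<union> OS0 \<union> CSAT0"
    by unfold_locales (auto simp: EPA_st_def EHA_st_def)
  show ?thesis by (rule interprets_PA2)
qed

end
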